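(* Let $\alpha \in \mathbb{R}$ and $r > 0$. Then the distribution $\mathcal{F}^\alpha Ш_r \in \mathscr{S}'(\mathbb{R})$ has discrete support if and only if the real numbers $r\cos\frac{\pi\alpha}{2}$ and $\frac{1}{r}\sin\frac{\pi\alpha}{2}$ are linearly dependent over $\mathbb{Z}$. Otherwise (that is, if they are linearly independent over $\mathbb{Z}$), $\operatorname{supp}\mathcal{F}^\alpha Ш_r = \mathbb{R}$.
   Context: For $r>0$, the Dirac comb is the tempered distribution $Ш_r = \sqrt{r}\sum_{k\in\mathbb{Z}}\delta(x-rk)\in\mathscr{S}'(\mathbb{R})$. Fractional Fourier transform: for $\alpha\in(-2,2)\setminus\{0\}$ and $f\in\mathscr{S}(\mathbb{R})$, $$\mathcal{F}^\alpha f(x) = \frac{1}{\sqrt{\mathrm{i}\sin(\pi\alpha/2)}}\int e^{\frac{\pi \mathrm{i}}{\sin(\pi\alpha/2)}(\cos(\pi\alpha/2)(x^2+y^2)-2xy)}f(y)\,dy,$$ with the square root having positive real part; $\mathcal{F}^0 f=f$; and $\mathcal{F}^2f(x) = -\mathrm{i}f(-x)$, so that the definition extends to all real exponents by $\mathcal{F}^{\alpha+2k}f(x) = e^{-\frac{\pi \mathrm{i}}{2}k}\mathcal{F}^\alpha f((-1)^kx)$ for $k\in\mathbb{Z}$, $\alpha\in(-2,2)$. Each $\mathcal{F}^\alpha$ is an automorphism of $\mathscr{S}(\mathbb{R})$ and extends (weakly continuously) to $\mathscr{S}'(\mathbb{R})$. *)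

theory Defs
  imports "HOL-Analysis.Analysis" "HOL-Probability.Sinc_Integral"
begin

section \<open>Schwartz functions and tempered distributions on the real line\<close>

text \<open>The library's \<^const>\<open>deriv\<close> needs domain and codomain to coincide, hence the iterated
  \<^const>\<open>vector_derivative\<close> for complex functions of a real variable.\<close>

definition nth_vderiv :: "nat \<Rightarrow> (real \<Rightarrow> complex) \<Rightarrow> real \<Rightarrow> complex" where
  "nth_vderiv n f = ((\<lambda>g x. vector_derivative g (at x)) ^^ n) f"

definition smooth :: "(real \<Rightarrow> complex) \<Rightarrow> bool" where
  "smooth f \<longleftrightarrow> (\<forall>n x. nth_vderiv n f differentiable at x)"

definition schwartz :: "(real \<Rightarrow> complex) set" where
  "schwartz = {f. smooth f \<and> (\<forall>m n. bounded (range (\<lambda>x. x ^ m *\<^sub>R nth_vderiv n f x)))}"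

definition schwartz_seminorm :: "nat \<Rightarrow> nat \<Rightarrow> (real \<Rightarrow> complex) \<Rightarrow> real" where
  "schwartz_seminorm m n f = (SUP x. norm (x ^ m *\<^sub>R nth_vderiv n f x))"

text \<open>A distribution is a functional on functions of which only the values on \<^const>\<open>schwartz\<close>
  matter.\<close>

type_synonym functional = "(real \<Rightarrow> complex) \<Rightarrow> complex"

definition tempered_distribution :: "functional \<Rightarrow> bool" where
  "tempered_distribution u \<longleftrightarrow>
     (\<forall>\<phi>\<in>schwartz. \<forall>\<psi>\<in>schwartz. \<forall>a b. u (\<lambda>x. a * \<phi> x + b * \<psi> x) = a * u \<phi> + b * u \<psi>) \<and>
     (\<exists>C N. \<forall>\<phi>\<in>schwartz. norm (u \<phi>) \<le> C * (\<Sum>m\<le>N. \<Sum>n\<le>N. schwartz_seminorm m n \<phi>))"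

definition test_functions_on :: "real set \<Rightarrow> (real \<Rightarrow> complex) set" where
  "test_functions_on U =
     {\<phi>. smooth \<phi> \<and> compact (closure {x. \<phi> x \<noteq> 0}) \<and> closure {x. \<phi> x \<noteq> 0} \<subseteq> U}"

text \<open>The support is the complement of the largest open set on which the distribution vanishes.\<close>

definition dist_support :: "functional \<Rightarrow> real set" where
  "dist_support u = - \<Union>{U. open U \<and> (\<forall>\<phi>\<in>test_functions_on U. u \<phi> = 0)}"

definition regular_dist :: "(real \<Rightarrow> complex) \<Rightarrow> functional" where
  "regular_dist f \<phi> = (LINT x|lborel. f x * \<phi> x)"

definition dirac_comb :: "real \<Rightarrow> functional" where
  "dirac_comb r \<phi> = complex_of_real (sqrt r) * (\<Sum>\<^sub>\<infinity>k::int. \<phi> (r * of_int k))"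


section \<open>The fractional Fourier transform\<close>

definition frac_fourier_base :: "real \<Rightarrow> (real \<Rightarrow> complex) \<Rightarrow> real \<Rightarrow> complex" where
  "frac_fourier_base \<alpha> f x =
     (if \<alpha> = 0 then f x
      else 1 / csqrt (\<i> * of_real (sin (pi * \<alpha> / 2))) *
        (LINT y|lborel. exp (pi * \<i> / sin (pi * \<alpha> / 2) *
            (cos (pi * \<alpha> / 2) * (x\<^sup>2 + y\<^sup>2) - 2 * x * y)) * f y))"

text \<open>An exponent outside \<open>(-2, 2)\<close> is written as \<open>\<beta> + 2k\<close> with \<open>0 \<le> \<beta> < 2\<close>. The choice is
  immaterial: the extension formula holds for every \<open>\<alpha> \<in> (-2, 2)\<close> and every \<open>k\<close>, see
  \<open>frac_fourier_add_even\<close> below.\<close>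

definition frac_fourier :: "real \<Rightarrow> (real \<Rightarrow> complex) \<Rightarrow> real \<Rightarrow> complex" where
  "frac_fourier \<alpha> f x =
     (if \<bar>\<alpha>\<bar> < 2 then frac_fourier_base \<alpha> f x
      else let k = \<lfloor>\<alpha> / 2\<rfloor> in
        exp (- pi * \<i> / 2 * of_int k) * frac_fourier_base (\<alpha> - 2 * of_int k) f ((-1) powi k * x))"

text \<open>The extension to tempered distributions is by transposition, the transform being symmetric
  for the bilinear pairing \<open>\<integral> f g\<close>; \<open>frac_fourier_dist_regular_dist\<close> below shows that it
  restricts to \<^const>\<open>frac_fourier\<close> on Schwartz functions. Transposes are weakly continuous.\<close>

definition frac_fourier_dist :: "real \<Rightarrow> functional \<Rightarrow> functional" where
  "frac_fourier_dist \<alpha> u \<phi> = u (frac_fourier \<alpha> \<phi>)"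

text \<open>Linear dependence is that of the pair, not of the set \<open>{a, b}\<close>: equal numbers are dependent.\<close>

definition int_lin_dependent :: "real \<Rightarrow> real \<Rightarrow> bool" where
  "int_lin_dependent a b \<longleftrightarrow>
     (\<exists>m n :: int. (m, n) \<noteq> (0, 0) \<and> of_int m * a + of_int n * b = 0)"


section \<open>Consistency of the definitions\<close>

lemma frac_fourier_base_shift:
  assumes "0 < \<beta>" "\<beta> < 2"
  shows "frac_fourier_base (\<beta> - 2) f x = \<i> * frac_fourier_base \<beta> f (- x)"
proof -
  have arg: "pi * (\<beta> - 2) / 2 = pi * \<beta> / 2 - pi"
    by (simp add: field_simps)
  have s: "sin (pi * (\<beta> - 2) / 2) = - sin (pi * \<beta> / 2)"
    and c: "cos (pi * (\<beta> - 2) / 2) = - cos (pi * \<beta> / 2)"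
    unfolding arg by simp_all
  have pos: "sin (pi * \<beta> / 2) > 0"
    using assms by (intro sin_gt_zero) (auto simp: field_simps)
  define t where "t = sin (pi * \<beta> / 2)"
  have t: "t > 0" using pos by (simp add: t_def)
  have "csqrt (\<i> * complex_of_real t) = \<i> * csqrt (- (\<i> * complex_of_real t))"
    using csqrt_minus[of "- (\<i> * complex_of_real t)"] t by simp
  then have q: "csqrt (- (\<i> * complex_of_real t)) = - \<i> * csqrt (\<i> * complex_of_real t)"
    by simp
  have ne: "csqrt (\<i> * complex_of_real t) \<noteq> 0" using t by simp
  have e: "complex_of_real pi * \<i> / complex_of_real (- t) *
        complex_of_real (- cos (pi * \<beta> / 2) * (x\<^sup>2 + y\<^sup>2) - 2 * x * y) =
      complex_of_real pi * \<i> / complex_of_real t *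
        complex_of_real (cos (pi * \<beta> / 2) * ((-x)\<^sup>2 + y\<^sup>2) - 2 * (-x) * y)" for y
    using t by (simp add: field_simps)
  define J where "J = (LINT y|lborel. exp (complex_of_real pi * \<i> / complex_of_real t *
        complex_of_real (cos (pi * \<beta> / 2) * ((-x)\<^sup>2 + y\<^sup>2) - 2 * (-x) * y)) * f y)"
  have "frac_fourier_base (\<beta> - 2) f x = 1 / csqrt (- (\<i> * complex_of_real t)) * J"
    using assms unfolding frac_fourier_base_def s c J_def by (simp only: e flip: t_def) simp
  moreover have "frac_fourier_base \<beta> f (- x) = 1 / csqrt (\<i> * complex_of_real t) * J"
    using assms by (simp only: frac_fourier_base_def J_def t_def) simp
  ultimately show ?thesis
    by (simp add: q flip: minus_divide_left) (simp add: divide_inverse)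
qed

lemma frac_fourier_add_even:
  assumes "\<bar>\<alpha>\<bar> < 2"
  shows "frac_fourier (\<alpha> + 2 * of_int k) f x =
    exp (- pi * \<i> / 2 * of_int k) * frac_fourier \<alpha> f ((-1) powi k * x)"
proof -
  define G where "G k \<beta> x = exp (- pi * \<i> / 2 * of_int k) * frac_fourier_base \<beta> f ((-1) powi k * x)"
    for k :: int and \<beta> x
  have ei: "exp (- pi * \<i> / 2) = - \<i>" "exp (pi * \<i> / 2) = \<i>"
    by (simp_all add: exp_eq_polar cis.ctr complex_eq_iff Re_exp Im_exp)
  have G0: "G 0 \<beta> x = frac_fourier_base \<beta> f x" for \<beta> x
    by (simp add: G_def)
  have Gs: "G k (\<beta> - 2) x = G (k - 1) \<beta> x" if "0 < \<beta>" "\<beta> < 2" for k \<beta> x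
  proof -
    have "exp (- pi * \<i> / 2 * of_int (k - 1)) = exp (- pi * \<i> / 2 * of_int k) * exp (pi * \<i> / 2)"
      by (simp add: exp_add[symmetric] algebra_simps diff_divide_distrib)
    moreover have "(-1) powi (k - 1) * x = - ((-1) powi k * x)"
      by (simp add: power_int_diff)
    ultimately show ?thesis
      unfolding G_def ei by (simp add: frac_fourier_base_shift[OF that])
  qed
  have "frac_fourier (\<alpha> + 2 * of_int k) f x = G k \<alpha> x"
  proof (cases "\<alpha> \<ge> 0")
    case True
    have fl: "\<lfloor>(\<alpha> + 2 * of_int k) / 2\<rfloor> = k"
      using True assms by (intro floor_unique) (auto simp: field_simps)
    show ?thesis
    proof (cases "\<bar>\<alpha> + 2 * of_int k\<bar> < 2")
      case small: True
      then have "k = 0 \<or> k = -1" using True assms by linarith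
      then show ?thesis
      proof
        assume "k = -1"
        then show ?thesis
          using small True Gs[of \<alpha> 0 x] assms by (cases "\<alpha> = 0") (auto simp: frac_fourier_def G0)
      qed (use assms in \<open>simp add: frac_fourier_def G0\<close>)
    next
      case False
      then show ?thesis by (simp add: frac_fourier_def fl Let_def G_def)
    qed
  next
    case neg: False
    have fl: "\<lfloor>(\<alpha> + 2 * of_int k) / 2\<rfloor> = k - 1"
      using neg assms by (intro floor_unique) (auto simp: field_simps)
    have st: "G k \<alpha> x = G (k - 1) (\<alpha> + 2) x"
      using Gs[of "\<alpha> + 2" k x] neg assms by simp
    show ?thesis
    proof (cases "\<bar>\<alpha> + 2 * of_int k\<bar> < 2")
      case small: True
      then have "k = 0 \<or> k = 1" using neg assms by linarith
      then show ?thesis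
      proof
        assume "k = 1"
        then show ?thesis using small st by (simp add: frac_fourier_def G0)
      qed (use assms in \<open>simp add: frac_fourier_def G0\<close>)
    next
      case False
      moreover have "\<alpha> + 2 * of_int k - 2 * of_int (k - 1) = \<alpha> + 2" by simp
      ultimately show ?thesis unfolding st by (simp add: frac_fourier_def fl Let_def G_def)
    qed
  qed
  then show ?thesis
    using assms by (simp add: frac_fourier_def G_def)
qed

lemma schwartz_integrable:
  assumes "f \<in> schwartz"
  shows "integrable lborel f"
proof -
  have "nth_vderiv 0 f differentiable at x" for x
    using assms by (auto simp: schwartz_def smooth_def)
  then have "continuous_on UNIV f"
    by (auto simp: nth_vderiv_def intro!: continuous_at_imp_continuous_on differentiable_imp_continuous_within)
  then have meas: "f \<in> borel_measurable borel"
    by (rule borel_measurable_continuous_onI)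
  have bd: "bounded (range (\<lambda>x. x ^ m *\<^sub>R f x))" for m
  proof -
    have "bounded (range (\<lambda>x. x ^ m *\<^sub>R nth_vderiv 0 f x))"
      using assms unfolding schwartz_def by blast
    then show ?thesis by (simp add: nth_vderiv_def)
  qed
  obtain A where A: "norm (f x) \<le> A" for x
    using bd[of 0] by (auto simp: bounded_iff)
  obtain B where B: "norm (x ^ 2 *\<^sub>R f x) \<le> B" for x
    using bd[of 2] unfolding bounded_iff by blast
  have "norm (f x) \<le> (A + B) * inverse (1 + x\<^sup>2)" for x
  proof -
    have "norm (f x) * (1 + x\<^sup>2) \<le> A + B"
      using A[of x] B[of x] by (simp add: algebra_simps)
    moreover have "1 + x\<^sup>2 > 0" by (simp add: add_pos_nonneg)
    ultimately show ?thesis by (simp add: field_simps)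
  qed
  moreover have "integrable lborel (\<lambda>x::real. (A + B) * inverse (1 + x\<^sup>2))"
    using integrable_inverse_1_plus_square by (simp add: set_integrable_def einterval_def)
  moreover have "(A + B) * inverse (1 + x\<^sup>2) \<ge> 0" for x
    using norm_ge_zero order_trans calculation(1) by blast
  ultimately show ?thesis
    by (intro Bochner_Integration.integrable_bound[of _ "\<lambda>x. (A + B) * inverse (1 + x\<^sup>2)" f])
       (auto simp: meas)
qed

lemma frac_fourier_base_symmetric:
  assumes int: "integrable lborel f" "integrable lborel g"
  shows "(LINT x|lborel. frac_fourier_base \<alpha> f x * g x) =
    (LINT x|lborel. f x * frac_fourier_base \<alpha> g x)"
proof (cases "\<alpha> = 0")
  case False
  define K where "K x y = exp (pi * \<i> / sin (pi * \<alpha> / 2) *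
            (cos (pi * \<alpha> / 2) * (x\<^sup>2 + y\<^sup>2) - 2 * x * y))" for x y :: real
  define C where "C = 1 / csqrt (\<i> * of_real (sin (pi * \<alpha> / 2)))"
  have base: "frac_fourier_base \<alpha> h x = C * (LINT y|lborel. K x y * h y)" for h x
    using False by (simp add: frac_fourier_base_def K_def C_def)
  have Ksym: "K x y = K y x" for x y
    by (simp add: K_def algebra_simps)
  have Knorm: "norm (K x y) = 1" for x y
    by (simp add: K_def)
  have [measurable]: "f \<in> borel_measurable borel" "g \<in> borel_measurable borel"
    using int by auto
  have [measurable]: "(\<lambda>(x, y). K x y) \<in> borel_measurable (borel \<Otimes>\<^sub>M borel)"
    unfolding K_def by measurable
  have I: "integrable (lborel \<Otimes>\<^sub>M lborel) (\<lambda>(x, y). K x y * f y * g x)"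
  proof (rule lborel_pair.Fubini_integrable)
    show "integrable lborel (\<lambda>x. LINT y|lborel. norm (case (x, y) of (x, y) \<Rightarrow> K x y * f y * g x))"
      using int by (simp add: norm_mult Knorm)
    show "AE x in lborel. integrable lborel (\<lambda>y. case (x, y) of (x, y) \<Rightarrow> K x y * f y * g x)"
    proof (rule AE_I2)
      fix x
      have "integrable lborel (\<lambda>y. K x y * f y)"
        by (rule Bochner_Integration.integrable_bound[OF int(1)]) (auto simp: norm_mult Knorm)
      then show "integrable lborel (\<lambda>y. case (x, y) of (x, y) \<Rightarrow> K x y * f y * g x)"
        by simp
    qed
  qed measurable
  have "(LINT x|lborel. frac_fourier_base \<alpha> f x * g x) =
      C * (LINT x|lborel. LINT y|lborel. K x y * f y * g x)"
    by (simp add: base mult.assoc flip: integral_mult_left_zero)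
  also have "(LINT x|lborel. LINT y|lborel. K x y * f y * g x) =
      (LINT y|lborel. LINT x|lborel. K x y * f y * g x)"
    using lborel_pair.Fubini_integral[OF I] by simp
  also have "\<dots> = (LINT y|lborel. f y * (LINT x|lborel. K y x * g x))"
    by (subst Ksym) (simp add: mult.assoc mult.left_commute[of _ "f _"])
  also have "C * \<dots> = (LINT x|lborel. f x * frac_fourier_base \<alpha> g x)"
    by (simp add: base mult.left_commute)
  finally show ?thesis .
qed (simp add: frac_fourier_base_def)

lemma lborel_integral_uminus:
  fixes h :: "real \<Rightarrow> complex"
  shows "(LINT x|lborel. h (- x)) = (LINT x|lborel. h x)"
  using lborel_integral_real_affine[of "-1" h 0] by simp

lemma frac_fourier_base_uminus:
  "frac_fourier_base \<alpha> f (- x) = frac_fourier_base \<alpha> (\<lambda>y. f (- y)) x"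
  using lborel_integral_uminus[of "\<lambda>y. exp (pi * \<i> / sin (pi * \<alpha> / 2) *
            (cos (pi * \<alpha> / 2) * ((-x)\<^sup>2 + y\<^sup>2) - 2 * (-x) * y)) * f y"]
  by (simp add: frac_fourier_base_def)

theorem frac_fourier_dist_regular_dist:
  assumes "f \<in> schwartz" "g \<in> schwartz"
  shows "frac_fourier_dist \<alpha> (regular_dist f) g = regular_dist (frac_fourier \<alpha> f) g"
proof -
  have int: "integrable lborel f" "integrable lborel g"
    using assms by (auto intro: schwartz_integrable)
  have intm: "integrable lborel (\<lambda>x. g (- x))"
    using lborel_integrable_real_affine[OF int(2), of "-1" 0] by simp
  show ?thesis
  proof (cases "\<bar>\<alpha>\<bar> < 2")
  case True
  then show ?thesis
    using frac_fourier_base_symmetric[OF int]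
    by (simp add: frac_fourier_dist_def regular_dist_def frac_fourier_def)
next
  case False
  define k where "k = \<lfloor>\<alpha> / 2\<rfloor>"
  define \<beta> where "\<beta> = \<alpha> - 2 * of_int k"
  define c where "c = exp (- pi * \<i> / 2 * of_int k)"
  define s :: real where "s = (-1) powi k"
  have F: "frac_fourier \<alpha> h x = c * frac_fourier_base \<beta> h (s * x)" for h x
    using False by (simp add: frac_fourier_def k_def \<beta>_def c_def s_def Let_def)
  have "s = 1 \<or> s = -1"
    by (cases "even k") (auto simp: s_def)
  moreover have "(LINT x|lborel. f x * frac_fourier_base \<beta> g (- x)) =
      (LINT x|lborel. frac_fourier_base \<beta> f (- x) * g x)"
  proof -
    have "(LINT x|lborel. f x * frac_fourier_base \<beta> g (- x)) =
        (LINT x|lborel. frac_fourier_base \<beta> f x * g (- x))"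
      using frac_fourier_base_symmetric[OF int(1) intm]
      by (simp add: frac_fourier_base_uminus)
    then show ?thesis
      using lborel_integral_uminus[of "\<lambda>x. frac_fourier_base \<beta> f (- x) * g x"]
      by simp
  qed
  ultimately show ?thesis
    using frac_fourier_base_symmetric[OF int, of \<beta>]
    by (auto simp: frac_fourier_dist_def regular_dist_def F mult.left_commute mult.assoc)
qed
qed

end

theory Submission
  imports Defs
begin

text \<open>
  Write \<open>c = cos (\<pi>\<alpha>/2)\<close>, \<open>s = sin (\<pi>\<alpha>/2)\<close>, and let \<open>u\<close> be the transformed comb. The comb is fixed by
  translation by \<open>r\<close> and by multiplication with \<open>e\<^sup>2\<^sup>\<pi>\<^sup>i\<^sup>x\<^sup>/\<^sup>r\<close>, that is, up to signs, by the
  time-frequency shifts by the vectors \<open>(mr, n/r)\<close> with integers \<open>m, n\<close>. The fractional Fourier transform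
  intertwines time-frequency shifts with their rotations by \<open>\<pi>\<alpha>/2\<close>
  (\<open>frac_fourier_base_heisenberg\<close>), so \<open>u\<close> is fixed, up to signs, by the shifts by the rotated lattice
  of all \<open>(mrc - ns/r, mrs + nc/r)\<close> (\<open>comb_transform_heisenberg\<close>). The translation parts of these
  vectors form the group generated by \<open>rc\<close> and \<open>s/r\<close>, which is where linear dependence enters.

  If \<open>rc\<close> and \<open>s/r\<close> are dependent, the rotated lattice contains a vector \<open>(0, b)\<close> with \<open>b \<noteq> 0\<close>, and
  twice this vector fixes \<open>u\<close> without a sign. So \<open>u\<close> is annihilated by \<open>e\<^sup>4\<^sup>\<pi>\<^sup>i\<^sup>b\<^sup>x - 1\<close> and its support
  lies in the discrete zero set of this function (\<open>comb_transform_vanishes_off_lattice\<close>).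

  If they are independent, the translation parts are dense in the line. If \<open>u\<close> vanished on a
  nonempty open set, it would therefore vanish on all smooth functions of sufficiently short support,
  and so on their finite sums. But there is a compactly supported smooth function with nonzero pairing
  that is such a sum (\<open>comb_transform_chirped_bump_nonzero\<close>): take a bump \<open>h\<close> whose translates by the
  multiples of \<open>p = \<bar>s\<bar>/r\<close> sum to a constant, and multiply it by the chirp that cancels the quadratic
  phase of the kernel. The values of the transform at the points \<open>rk\<close> are then, up to nonzero
  factors, those of the Fourier transform of \<open>h\<close> at the points \<open>k/p\<close>, which are zero except for \<open>k = 0\<close>.
  Writing \<open>h\<close> as the difference of a smooth step and its translate by \<open>p\<close> makes both the vanishing and
  the decomposition into short pieces immediate.

  That \<open>u\<close> is tempered follows from the decay of order two of the transform, obtained from two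
  integrations by parts (\<open>frac_fourier_base_decay\<close>), which makes the sum over the lattice converge.
\<close>


section \<open>Calculus of smooth complex functions of a real variable\<close>

text \<open>Products, inverses and exponentials are handled by induction on a finite order of
  differentiability; smoothness is the conjunction of all orders. Both notions are local, so that
  a function given by different formulas on two open sets can be treated piecewise.\<close>

definition times_differentiable_on :: "nat \<Rightarrow> real set \<Rightarrow> (real \<Rightarrow> complex) \<Rightarrow> bool" where
  "times_differentiable_on n S f \<longleftrightarrow> (\<forall>k<n. \<forall>x\<in>S. nth_vderiv k f differentiable at x)"

definition smooth_on :: "real set \<Rightarrow> (real \<Rightarrow> complex) \<Rightarrow> bool" where
  "smooth_on S f \<longleftrightarrow> (\<forall>n. times_differentiable_on n S f)"

lemma smooth_on_alt: "smooth_on S f \<longleftrightarrow> (\<forall>n. \<forall>x\<in>S. nth_vderiv n f differentiable at x)"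
  unfolding smooth_on_def times_differentiable_on_def by blast

lemma smooth_iff: "smooth f \<longleftrightarrow> smooth_on UNIV f"
  by (simp add: smooth_def smooth_on_alt)

lemma smooth_on_Un: "smooth_on S f \<Longrightarrow> smooth_on T f \<Longrightarrow> smooth_on (S \<union> T) f"
  by (auto simp: smooth_on_alt)

lemma smooth_on_subset: "smooth_on S f \<Longrightarrow> T \<subseteq> S \<Longrightarrow> smooth_on T f"
  by (auto simp: smooth_on_alt)

lemma nth_vderiv_0 [simp]: "nth_vderiv 0 f = f"
  by (simp add: nth_vderiv_def)

lemma nth_vderiv_Suc: "nth_vderiv (Suc n) f = (\<lambda>x. vector_derivative (nth_vderiv n f) (at x))"
  by (simp add: nth_vderiv_def)

lemma nth_vderiv_Suc': "nth_vderiv (Suc n) f = nth_vderiv n (\<lambda>x. vector_derivative f (at x))"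
  by (simp add: nth_vderiv_def funpow_Suc_right del: funpow.simps)

lemma vector_derivative_cong_open:
  fixes f g :: "real \<Rightarrow> complex"
  assumes "open S" "x \<in> S" "\<And>y. y \<in> S \<Longrightarrow> f y = g y"
  shows "vector_derivative f (at x) = vector_derivative g (at x)"
proof -
  have "eventually (\<lambda>y. f y = g y) (nhds x)"
    using assms by (auto simp: eventually_nhds)
  then show ?thesis
    by (intro vector_derivative_cong_eq) (auto simp: eventually_nhds)
qed

lemma differentiable_cong_open:
  fixes f g :: "real \<Rightarrow> complex"
  assumes "open S" "x \<in> S" "\<And>y. y \<in> S \<Longrightarrow> f y = g y"
  shows "f differentiable at x \<longleftrightarrow> g differentiable at x"
  using assms unfolding differentiable_def
  by (metis has_derivative_transform_within_open)

lemma nth_vderiv_cong_open: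
  assumes "open S" "\<And>y. y \<in> S \<Longrightarrow> f y = g y" "x \<in> S"
  shows "nth_vderiv n f x = nth_vderiv n g x"
  using assms(3)
proof (induction n arbitrary: x)
  case (Suc n)
  then show ?case
    unfolding nth_vderiv_Suc using vector_derivative_cong_open[OF assms(1)] by blast
qed (use assms in auto)

lemma times_differentiable_on_cong:
  assumes "open S" "\<And>y. y \<in> S \<Longrightarrow> f y = g y" 
  shows "times_differentiable_on n S f \<longleftrightarrow> times_differentiable_on n S g"
proof -
  have "nth_vderiv k f differentiable at x \<longleftrightarrow> nth_vderiv k g differentiable at x" if "x \<in> S" for k x
    by (rule differentiable_cong_open[OF assms(1) that nth_vderiv_cong_open[OF assms]])
  then show ?thesis
    unfolding times_differentiable_on_def by blast
qed

lemma smooth_on_cong: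
  assumes "open S" "\<And>y. y \<in> S \<Longrightarrow> f y = g y" 
  shows "smooth_on S f \<longleftrightarrow> smooth_on S g"
  unfolding smooth_on_def using times_differentiable_on_cong[OF assms] by simp

lemma times_differentiable_on_0 [simp]: "times_differentiable_on 0 S f"
  by (simp add: times_differentiable_on_def)

text \<open>The induction step of all closure properties below. A derivative known only on the open set
  \<open>S\<close> suffices, since iterated derivatives on \<open>S\<close> depend only on the values there.\<close>

lemma times_differentiable_on_SucI:
  assumes "open S" and f': "\<And>x. x \<in> S \<Longrightarrow> (f has_vector_derivative f' x) (at x)"
    and "times_differentiable_on n S f'"
  shows "times_differentiable_on (Suc n) S f"
proof -
  have v: "vector_derivative f (at x) = f' x" if "x \<in> S" for x
    using f'[OF that] by (rule vector_derivative_at)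
  have "times_differentiable_on n S (\<lambda>x. vector_derivative f (at x))"
    using assms(3) times_differentiable_on_cong[OF assms(1), of "\<lambda>x. vector_derivative f (at x)" f'] v
    by blast
  then show ?thesis
    using f' by (auto simp: times_differentiable_on_def nth_vderiv_Suc' less_Suc_eq_0_disj
        intro: differentiableI_vector)
qed

lemma times_differentiable_on_SucD:
  assumes "times_differentiable_on (Suc n) S f"
  shows "x \<in> S \<Longrightarrow> (f has_vector_derivative vector_derivative f (at x)) (at x)"
    and "times_differentiable_on n S (\<lambda>x. vector_derivative f (at x))"
proof -
  have *: "nth_vderiv k f differentiable at x" if "k < Suc n" "x \<in> S" for k x
    using assms that by (simp add: times_differentiable_on_def)
  show "x \<in> S \<Longrightarrow> (f has_vector_derivative vector_derivative f (at x)) (at x)"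
    using *[of 0 x] by (simp add: vector_derivative_works)
  show "times_differentiable_on n S (\<lambda>x. vector_derivative f (at x))"
    using *[of "Suc _"] by (simp add: times_differentiable_on_def nth_vderiv_Suc')
qed

lemma times_differentiable_on_Suc_imp:
  "times_differentiable_on (Suc n) S f \<Longrightarrow> times_differentiable_on n S f"
  by (simp add: times_differentiable_on_def)

text \<open>Bootstrapping, for functions that occur in their own derivative.\<close>

lemma smooth_onI:
  assumes "\<And>n. times_differentiable_on n S f \<Longrightarrow> times_differentiable_on (Suc n) S f"
  shows "smooth_on S f"
proof -
  have "times_differentiable_on n S f" for n
    by (induction n) (use assms in auto)
  then show ?thesis by (simp add: smooth_on_def)
qed

lemma smooth_on_has_vderiv:
  "smooth_on S f \<Longrightarrow> x \<in> S \<Longrightarrow> (f has_vector_derivative vector_derivative f (at x)) (at x)"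
  unfolding smooth_on_def using times_differentiable_on_SucD(1) by blast

lemma smooth_on_vderiv:
  "smooth_on S f \<Longrightarrow> smooth_on S (\<lambda>x. vector_derivative f (at x))"
  unfolding smooth_on_def using times_differentiable_on_SucD(2) by blast

lemma smooth_on_continuous: "smooth_on S f \<Longrightarrow> continuous_on S f"
  by (meson continuous_at_imp_continuous_on has_vector_derivative_continuous smooth_on_has_vderiv)

lemma times_differentiable_on_const: "open S \<Longrightarrow> times_differentiable_on n S (\<lambda>x. c)"
proof (induction n arbitrary: c)
  case (Suc n)
  then show ?case
    by (intro times_differentiable_on_SucI[where f' = "\<lambda>x. 0"]) (auto intro!: derivative_eq_intros)
qed auto

lemma times_differentiable_on_add:
  "open S \<Longrightarrow> times_differentiable_on n S f \<Longrightarrow> times_differentiable_on n S g \<Longrightarrow>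
    times_differentiable_on n S (\<lambda>x. f x + g x)"
proof (induction n arbitrary: f g)
  case (Suc n)
  show ?case
    by (rule times_differentiable_on_SucI[OF \<open>open S\<close>])
       (use Suc in \<open>auto intro!: has_vector_derivative_add times_differentiable_on_SucD\<close>)
qed auto

lemma times_differentiable_on_mult:
  "open S \<Longrightarrow> times_differentiable_on n S f \<Longrightarrow> times_differentiable_on n S g \<Longrightarrow>
    times_differentiable_on n S (\<lambda>x. f x * g x)"
proof (induction n arbitrary: f g)
  case (Suc n)
  show ?case
    by (rule times_differentiable_on_SucI[OF \<open>open S\<close>])
       (use Suc in \<open>auto intro!: has_vector_derivative_mult times_differentiable_on_add Suc.IH
          intro: times_differentiable_on_SucD times_differentiable_on_Suc_imp\<close>)
qed auto

lemma smooth_on_const: "open S \<Longrightarrow> smooth_on S (\<lambda>x. c)"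
  by (simp add: smooth_on_def times_differentiable_on_const)

lemma smooth_on_add:
  "open S \<Longrightarrow> smooth_on S f \<Longrightarrow> smooth_on S g \<Longrightarrow> smooth_on S (\<lambda>x. f x + g x)"
  by (simp add: smooth_on_def times_differentiable_on_add)

lemma smooth_on_mult:
  "open S \<Longrightarrow> smooth_on S f \<Longrightarrow> smooth_on S g \<Longrightarrow> smooth_on S (\<lambda>x. f x * g x)"
  by (simp add: smooth_on_def times_differentiable_on_mult)

lemma smooth_on_diff:
  assumes "open S" "smooth_on S f" "smooth_on S g"
  shows "smooth_on S (\<lambda>x. f x - g x)"
  using smooth_on_add[OF assms(1,2) smooth_on_mult[OF assms(1) smooth_on_const[of S "-1"] assms(3)]]
    assms(1) by simp

lemma smooth_on_of_real:
  assumes "open S"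
  shows "smooth_on S (\<lambda>x. of_real x)"
proof (rule smooth_onI)
  show "times_differentiable_on (Suc n) S (\<lambda>x. of_real x)" for n
    by (rule times_differentiable_on_SucI[OF assms, where f' = "\<lambda>x. 1"])
       (auto intro!: times_differentiable_on_const assms has_vector_derivative_of_real derivative_eq_intros)
qed

text \<open>The derivative of \<open>exp \<circ> f\<close> or \<open>1 / f\<close> is a polynomial in that function and \<open>f'\<close>, so one
  more derivative of \<open>f\<close> yields one more derivative of the composite.\<close>

lemma smooth_on_exp:
  assumes "open S" "smooth_on S f"
  shows "smooth_on S (\<lambda>x. exp (f x))"
proof (rule smooth_onI)
  fix n assume IH: "times_differentiable_on n S (\<lambda>x. exp (f x))"
  show "times_differentiable_on (Suc n) S (\<lambda>x. exp (f x))"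
  proof (rule times_differentiable_on_SucI[OF assms(1)])
    show "((\<lambda>x. exp (f x)) has_vector_derivative vector_derivative f (at x) * exp (f x)) (at x)"
      if "x \<in> S" for x
      using field_vector_diff_chain_at[OF smooth_on_has_vderiv[OF assms(2) that] DERIV_exp]
      by (simp add: o_def)
  qed (use assms IH smooth_on_vderiv in \<open>auto simp: smooth_on_def intro!: times_differentiable_on_mult\<close>)
qed

lemma smooth_on_inverse:
  assumes "open S" "smooth_on S f" "\<And>x. x \<in> S \<Longrightarrow> f x \<noteq> 0"
  shows "smooth_on S (\<lambda>x. inverse (f x))"
proof (rule smooth_onI)
  fix n assume IH: "times_differentiable_on n S (\<lambda>x. inverse (f x))"
  show "times_differentiable_on (Suc n) S (\<lambda>x. inverse (f x))"
  proof (rule times_differentiable_on_SucI[OF assms(1)])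
    show "((\<lambda>x. inverse (f x)) has_vector_derivative
        (-1) * (vector_derivative f (at x) * (inverse (f x) * inverse (f x)))) (at x)"
      if "x \<in> S" for x
      using field_vector_diff_chain_at[OF smooth_on_has_vderiv[OF assms(2) that]
          DERIV_inverse[OF assms(3)[OF that]]]
      by (simp add: o_def power2_eq_square)
    show "times_differentiable_on n S
        (\<lambda>x. (-1) * (vector_derivative f (at x) * (inverse (f x) * inverse (f x))))"
      using assms smooth_on_vderiv[OF assms(2)]
      by (intro times_differentiable_on_mult times_differentiable_on_const IH) (auto simp: smooth_on_def)
  qed
qed

lemma smooth_on_affine:
  assumes "smooth_on UNIV f"
  shows "smooth_on UNIV (\<lambda>x. f (a * x + b))"
proof -
  have "times_differentiable_on n UNIV (\<lambda>x. f (a * x + b))" if "times_differentiable_on n UNIV f"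
    for n and f :: "real \<Rightarrow> complex"
    using that
  proof (induction n arbitrary: f)
    case (Suc n)
    show ?case
    proof (rule times_differentiable_on_SucI)
      show "((\<lambda>x. f (a * x + b)) has_vector_derivative
          of_real a * vector_derivative f (at (a * x + b))) (at x)" for x
      proof -
        have "((\<lambda>x. a * x + b) has_vector_derivative a) (at x)"
          unfolding has_real_derivative_iff_has_vector_derivative[symmetric]
          by (auto intro!: derivative_eq_intros)
        from vector_diff_chain_at[OF this times_differentiable_on_SucD(1)[OF Suc.prems]]
        show ?thesis by (simp add: o_def scaleR_conv_of_real)
      qed
      show "times_differentiable_on n UNIV (\<lambda>x. of_real a * vector_derivative f (at (a * x + b)))"
        by (intro times_differentiable_on_mult times_differentiable_on_const Suc.IH)
           (auto intro: times_differentiable_on_SucD Suc.prems)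
    qed auto
  qed auto
  then show ?thesis using assms by (simp add: smooth_on_def)
qed


section \<open>Smooth steps\<close>

text \<open>The family \<open>x\<^bsup>-j\<^esup> e\<^bsup>-1/x\<^esup>\<close> is closed under differentiation up to linear combinations,
  also at the origin; the flat function itself is the member \<open>j = 0\<close>.\<close>

definition flat :: "nat \<Rightarrow> real \<Rightarrow> real" where
  "flat j x = (if x > 0 then inverse x ^ j * exp (- inverse x) else 0)"

lemma flat_at_0: "(flat j \<longlongrightarrow> 0) (at 0)"
proof (rule filterlim_split_at)
  show "(flat j \<longlongrightarrow> 0) (at_left 0)"
    by (rule tendsto_eventually) (auto simp: eventually_at_filter flat_def)
  have "((\<lambda>y::real. y ^ j / exp y) \<longlongrightarrow> 0) at_top"
    by (rule tendsto_power_div_exp_0)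
  then have "((\<lambda>x::real. inverse x ^ j / exp (inverse x)) \<longlongrightarrow> 0) (at_right 0)"
    by (rule filterlim_compose[OF _ filterlim_inverse_at_top_right])
  then show "(flat j \<longlongrightarrow> 0) (at_right 0)"
    by (rule Lim_transform_eventually)
       (auto simp: eventually_at_filter flat_def exp_minus field_simps)
qed

lemma flat_deriv:
  "(flat j has_real_derivative flat (j + 2) x - real j * flat (j + 1) x) (at x)"
proof (cases x "0 :: real" rule: linorder_cases)
  case less
  have "((\<lambda>x. 0) has_real_derivative 0) (at x)" by simp
  then have "(flat j has_real_derivative 0) (at x)"
    by (rule has_field_derivative_transform_within_open[where S = "{..<0}"]) (use less in \<open>auto simp: flat_def\<close>)
  then show ?thesis using less by (simp add: flat_def)
next
  case equal
  have "((\<lambda>x. (flat j x - flat j 0) / (x - 0)) \<longlongrightarrow> 0) (at 0)"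
  proof (rule Lim_transform_eventually[OF flat_at_0[of "Suc j"]])
    show "\<forall>\<^sub>F x in at 0. flat (Suc j) x = (flat j x - flat j 0) / (x - 0)"
      by (auto simp: eventually_at_filter flat_def field_simps)
  qed
  then show ?thesis
    using equal by (simp add: has_field_derivative_iff flat_def)
next
  case greater
  have "((\<lambda>x. inverse x ^ j * exp (- inverse x)) has_real_derivative
      flat (j + 2) x - real j * flat (j + 1) x) (at x)"
  proof -
    have "real j * inverse x ^ (j - 1) * - (inverse x ^ 2) = - (real j * inverse x ^ (j + 1))"
      by (cases j) (auto simp: power2_eq_square)
    then show ?thesis
      using greater
      by (auto intro!: derivative_eq_intros simp: flat_def power2_eq_square algebra_simps)
  qed
  then show ?thesis
    by (rule has_field_derivative_transform_within_open[where S = "{0<..}"]) (use greater in \<open>auto simp: flat_def\<close>)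
qed

lemma smooth_on_flat: "smooth_on UNIV (\<lambda>x. of_real (flat 0 x))"
proof -
  have "times_differentiable_on n UNIV (\<lambda>x. of_real (flat j x))" for n j
  proof (induction n arbitrary: j)
    case (Suc n)
    show ?case
    proof (rule times_differentiable_on_SucI)
      show "((\<lambda>x. of_real (flat j x)) has_vector_derivative
          of_real (flat (j + 2) x) + (- of_real (real j)) * of_real (flat (j + 1) x)) (at x)" for x
        using has_vector_derivative_of_real[OF flat_deriv[of j x]] by simp
      show "times_differentiable_on n UNIV
          (\<lambda>x. of_real (flat (j + 2) x) + (- of_real (real j)) * of_real (flat (j + 1) x))"
        by (intro times_differentiable_on_add times_differentiable_on_mult
           times_differentiable_on_const Suc.IH) auto
    qed auto
  qed auto
  then show ?thesis by (simp add: smooth_on_def)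
qed

lemma smooth_step_exists:
  fixes e :: real
  assumes "e > 0"
  obtains H where "smooth_on UNIV H" "\<And>x. x \<le> 0 \<Longrightarrow> H x = 0" "\<And>x. x \<ge> e \<Longrightarrow> H x = 1"
proof -
  \<comment> \<open>\<open>F x\<close> and \<open>F (e - x)\<close> never vanish together, so their normalized quotient is smooth.\<close>
  define F where "F = (\<lambda>x. complex_of_real (flat 0 x))"
  define H where "H x = F x * inverse (F x + F (-1 * x + e))" for x
  have pos: "flat 0 x + flat 0 (-1 * x + e) > 0" for x
    using assms by (auto simp: flat_def add_pos_pos)
  have "F x + F (-1 * x + e) \<noteq> 0" for x
    using pos[of x] unfolding F_def of_real_add[symmetric] of_real_eq_0_iff by linarith
  then have "smooth_on UNIV H"
    unfolding H_def using smooth_on_flat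
    by (intro smooth_on_mult smooth_on_inverse smooth_on_add smooth_on_affine) (auto simp: F_def)
  moreover have "H x = 0" if "x \<le> 0" for x
    using that by (simp add: H_def F_def flat_def)
  moreover have "H x = 1" if "x \<ge> e" for x
    using that assms by (simp add: H_def F_def flat_def)
  ultimately show ?thesis using that by blast
qed


section \<open>Decay of the fractional Fourier transform\<close>

lemma inverse_1_plus_square_integrable: "integrable lborel (\<lambda>x::real. inverse (1 + x\<^sup>2))"
  using integrable_inverse_1_plus_square by (simp add: set_integrable_def einterval_def)

lemma inverse_1_plus_square_at_infinity: "((\<lambda>x::real. inverse (1 + x\<^sup>2)) \<longlongrightarrow> 0) at_infinity"
proof (rule Lim_null_comparison)
  have "norm (inverse (1 + x\<^sup>2)) \<le> norm (inverse x)" if "norm x \<ge> 1" for x :: real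
  proof -
    have "\<bar>x\<bar> * 1 \<le> \<bar>x\<bar> * \<bar>x\<bar>" using that by (intro mult_left_mono) auto
    then have "\<bar>x\<bar> \<le> 1 + x\<^sup>2" by (simp add: power2_eq_square)
    then show ?thesis using that by (simp add: le_imp_inverse_le)
  qed
  then show "\<forall>\<^sub>F x in at_infinity. norm (inverse (1 + x\<^sup>2)) \<le> norm (inverse x :: real)"
    unfolding eventually_at_infinity by blast
  show "((\<lambda>x::real. norm (inverse x)) \<longlongrightarrow> 0) at_infinity"
    by (rule tendsto_norm_zero[OF tendsto_inverse_0])
qed

lemma integral_bound_inverse_1_plus_square:
  fixes f :: "real \<Rightarrow> complex"
  assumes "continuous_on UNIV f" "\<And>x. norm (f x) \<le> A * inverse (1 + x\<^sup>2)"
  shows "integrable lborel f" "norm (LINT x|lborel. f x) \<le> A * (LINT x|lborel. inverse (1 + x\<^sup>2))"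
proof -
  have i: "integrable lborel (\<lambda>x. A * inverse (1 + x\<^sup>2))"
    using inverse_1_plus_square_integrable by simp
  show int: "integrable lborel f"
    by (rule Bochner_Integration.integrable_bound[OF i])
       (use assms in \<open>auto intro!: borel_measurable_continuous_onI order_trans[OF assms(2)]
          simp del: inverse_eq_divide\<close>)
  have "norm (LINT x|lborel. f x) \<le> (LINT x|lborel. norm (f x))" by simp
  also have "\<dots> \<le> (LINT x|lborel. A * inverse (1 + x\<^sup>2))"
    using int i assms(2) by (intro integral_mono) auto
  finally show "norm (LINT x|lborel. f x) \<le> A * (LINT x|lborel. inverse (1 + x\<^sup>2))" by simp
qed

lemma integral_vector_derivative_real_line:
  fixes f f' :: "real \<Rightarrow> complex"
  assumes "\<And>x. (f has_vector_derivative f' x) (at x)" "continuous_on UNIV f'" "integrable lborel f'"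
    and "(f \<longlongrightarrow> A) at_bot" "(f \<longlongrightarrow> B) at_top"
  shows "(LINT x|lborel. f' x) = B - A"
proof -
  have "(LBINT x=-\<infinity>..\<infinity>. f' x) = B - A"
    by (rule interval_integral_FTC_integrable[of _ _ f])
       (use assms in \<open>auto simp: ereal_tendsto_simps set_integrable_def continuous_on_eq_continuous_at\<close>)
  then show ?thesis
    by (simp add: interval_lebesgue_integral_def set_lebesgue_integral_def)
qed

text \<open>One integration by parts against a chirp: differentiating the quadratic part of the phase
  turns \<open>f'\<close> into \<open>f' + 2iayf\<close>, whereas the linear part gives the factor gained.\<close>

lemma chirp_by_parts:
  fixes f f' :: "real \<Rightarrow> complex" and a l :: real
  defines "e \<equiv> \<lambda>y. exp (\<i> * of_real (a * y\<^sup>2 + l * y))"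
  assumes f': "\<And>y. (f has_vector_derivative f' y) (at y)" "continuous_on UNIV f'"
    and A: "\<And>y. norm (f y) \<le> A * inverse (1 + y\<^sup>2)"
    and B: "\<And>y. norm (f' y + 2 * \<i> * a * y * f y) \<le> B * inverse (1 + y\<^sup>2)"
  shows "\<i> * l * (LINT y|lborel. e y * f y) = - (LINT y|lborel. e y * (f' y + 2 * \<i> * a * y * f y))"
proof -
  have ne: "norm (e y) = 1" for y by (simp add: e_def)
  have ce: "continuous_on UNIV e" unfolding e_def by (intro continuous_intros)
  have cf: "continuous_on UNIV f"
    using f'(1) by (meson continuous_at_imp_continuous_on has_vector_derivative_continuous)
  have i1: "integrable lborel (\<lambda>y. e y * f y)"
    using A by (intro integral_bound_inverse_1_plus_square(1)[of _ A] continuous_intros ce cf)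
      (simp add: norm_mult ne)
  have i2: "integrable lborel (\<lambda>y. e y * (f' y + 2 * \<i> * a * y * f y))"
    using B by (intro integral_bound_inverse_1_plus_square(1)[of _ B] continuous_intros ce cf f')
      (simp add: norm_mult ne)
  have de: "(e has_vector_derivative \<i> * of_real (2 * a * y + l) * e y) (at y)" for y
  proof -
    have "((\<lambda>y. a * y\<^sup>2 + l * y) has_real_derivative 2 * a * y + l) (at y)"
      by (auto intro!: derivative_eq_intros)
    then have "((\<lambda>y. \<i> * of_real (a * y\<^sup>2 + l * y)) has_vector_derivative \<i> * of_real (2 * a * y + l)) (at y)"
      by (intro has_vector_derivative_mult_right has_vector_derivative_of_real)
    from field_vector_diff_chain_at[OF this DERIV_exp] show ?thesis
      by (simp add: o_def e_def)
  qed
  let ?D = "\<lambda>y. \<i> * l * (e y * f y) + e y * (f' y + 2 * \<i> * a * y * f y)"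
  have "(LINT y|lborel. ?D y) = 0 - 0"
  proof (rule integral_vector_derivative_real_line)
    show "((\<lambda>y. e y * f y) has_vector_derivative ?D y) (at y)" for y
      using has_vector_derivative_mult[OF de[of y] f'(1)[of y]] by (simp add: algebra_simps)
    show "continuous_on UNIV ?D" by (intro continuous_intros ce cf f')
    show "integrable lborel ?D" using i1 i2 by simp
    have "((\<lambda>y. e y * f y) \<longlongrightarrow> 0) at_infinity"
    proof (rule Lim_null_comparison)
      show "\<forall>\<^sub>F y in at_infinity. norm (e y * f y) \<le> A * inverse (1 + y\<^sup>2)"
        using A by (simp add: norm_mult ne)
      show "((\<lambda>y. A * inverse (1 + y\<^sup>2)) \<longlongrightarrow> 0) at_infinity"
        using tendsto_mult_right_zero[OF inverse_1_plus_square_at_infinity] .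
    qed
    then show "((\<lambda>y. e y * f y) \<longlongrightarrow> 0) at_bot" "((\<lambda>y. e y * f y) \<longlongrightarrow> 0) at_top"
      by (auto intro: filterlim_mono at_bot_le_at_infinity at_top_le_at_infinity)
  qed
  then show ?thesis using i1 i2 by (simp add: eq_neg_iff_add_eq_0)
qed

abbreviation schwartz_norm :: "nat \<Rightarrow> (real \<Rightarrow> complex) \<Rightarrow> real" where
  "schwartz_norm N \<phi> \<equiv> \<Sum>m\<le>N. \<Sum>n\<le>N. schwartz_seminorm m n \<phi>"

lemma schwartz_bdd:
  assumes "\<phi> \<in> schwartz"
  shows "bdd_above (range (\<lambda>x. norm (x ^ m *\<^sub>R nth_vderiv n \<phi> x)))"
proof -
  have "bounded (range (\<lambda>x. x ^ m *\<^sub>R nth_vderiv n \<phi> x))"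
    using assms unfolding schwartz_def by blast
  then show ?thesis unfolding bounded_iff bdd_above_def by blast
qed

lemma schwartz_seminorm_upper:
  assumes "\<phi> \<in> schwartz"
  shows "\<bar>x\<bar> ^ m * norm (nth_vderiv n \<phi> x) \<le> schwartz_seminorm m n \<phi>"
  using cSUP_upper[OF UNIV_I schwartz_bdd[OF assms], of x m n]
  by (simp add: schwartz_seminorm_def power_abs)

lemma schwartz_norm_upper:
  assumes "\<phi> \<in> schwartz" "m \<le> N" "n \<le> N"
  shows "\<bar>x\<bar> ^ m * norm (nth_vderiv n \<phi> x) \<le> schwartz_norm N \<phi>"
proof -
  have nn: "schwartz_seminorm i j \<phi> \<ge> 0" for i j
    using schwartz_seminorm_upper[OF assms(1), of 0 i j] order_trans zero_le_mult_iff
    by (smt (verit, best) norm_ge_zero zero_le_power)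
  have "\<bar>x\<bar> ^ m * norm (nth_vderiv n \<phi> x) \<le> schwartz_seminorm m n \<phi>"
    by (rule schwartz_seminorm_upper[OF assms(1)])
  also have "\<dots> \<le> (\<Sum>j\<le>N. schwartz_seminorm m j \<phi>)"
    using assms nn by (intro member_le_sum) auto
  also have "\<dots> \<le> schwartz_norm N \<phi>"
    using assms nn by (intro member_le_sum[of m _ "\<lambda>m. \<Sum>j\<le>N. schwartz_seminorm m j \<phi>"]) (auto intro: sum_nonneg)
  finally show ?thesis .
qed

lemma schwartz_smooth: "\<phi> \<in> schwartz \<Longrightarrow> smooth_on UNIV \<phi>"
  by (simp add: schwartz_def smooth_iff)

text \<open>Two integrations by parts turn \<open>\<phi>\<close> into \<open>\<phi>'' + 4iay\<phi>' + (2ia - 4a\<^sup>2y\<^sup>2)\<phi>\<close>. Bounding this by a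
  multiple of \<open>1 / (1 + y\<^sup>2)\<close> costs two more powers of \<open>y\<close>, whence the order four of the norm.\<close>

lemma chirp_transform_decay:
  fixes a l :: real
  assumes \<phi>: "\<phi> \<in> schwartz"
  defines "J \<equiv> LINT y|lborel. exp (\<i> * of_real (a * y\<^sup>2 + l * y)) * \<phi> y"
    and "I \<equiv> LINT x|lborel. inverse (1 + x\<^sup>2)"
  shows "norm J \<le> 2 * schwartz_norm 4 \<phi> * I"
    and "l\<^sup>2 * norm J \<le> (2 + 12 * \<bar>a\<bar> + 8 * a\<^sup>2) * schwartz_norm 4 \<phi> * I"
proof -
  define Q where "Q = schwartz_norm 4 \<phi>"
  \<comment> \<open>Below, \<open>g0\<close> and \<open>h\<close> are the amplitudes after one and two integrations by parts.\<close>
  define f0 where "f0 = \<phi>"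
  define f1 where "f1 = (\<lambda>x. vector_derivative f0 (at x))"
  define f2 where "f2 = (\<lambda>x. vector_derivative f1 (at x))"
  note sm = schwartz_smooth[OF \<phi>]
  have s0: "smooth_on UNIV f0" and s1: "smooth_on UNIV f1" and s2: "smooth_on UNIV f2"
    using sm by (auto simp: f0_def f1_def f2_def intro!: smooth_on_vderiv)
  have d0: "(f0 has_vector_derivative f1 x) (at x)" and d1: "(f1 has_vector_derivative f2 x) (at x)" for x
    using smooth_on_has_vderiv[OF s0] smooth_on_has_vderiv[OF s1] by (auto simp: f1_def f2_def)
  note cont = smooth_on_continuous[OF s0] smooth_on_continuous[OF s1] smooth_on_continuous[OF s2]
  have n1: "nth_vderiv 1 \<phi> = f1" by (simp add: nth_vderiv_Suc f1_def f0_def)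
  have n2: "nth_vderiv 2 \<phi> = f2" by (simp add: nth_vderiv_Suc f1_def f2_def f0_def numeral_2_eq_2)
  have q0: "\<bar>x\<bar> ^ m * norm (f0 x) \<le> Q" if "m \<le> 4" for x m
    using schwartz_norm_upper[OF \<phi> that, of 0] by (simp add: Q_def f0_def)
  have q1: "\<bar>x\<bar> ^ m * norm (f1 x) \<le> Q" if "m \<le> 4" for x m
    using schwartz_norm_upper[OF \<phi> that, of 1] by (simp add: Q_def n1[simplified])
  have q2: "\<bar>x\<bar> ^ m * norm (f2 x) \<le> Q" if "m \<le> 4" for x m
    using schwartz_norm_upper[OF \<phi> that, of 2] by (simp add: Q_def n2)
  have div: "X \<le> M * inverse (1 + y\<^sup>2)" if "(1 + y\<^sup>2) * X \<le> M" for X M y :: real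
    using that by (simp add: field_simps add_pos_nonneg)
  have b0: "norm (f0 y) \<le> 2 * Q * inverse (1 + y\<^sup>2)" for y
    using q0[of 0 y] q0[of 2 y] by (intro div) (simp add: algebra_simps)
  define e where "e = (\<lambda>y. exp (\<i> * of_real (a * y\<^sup>2 + l * y)))"
  have ne: "norm (e y) = 1" for y by (simp add: e_def)
  have ce: "continuous_on UNIV e" unfolding e_def by (intro continuous_intros)
  have J: "J = (LINT y|lborel. e y * f0 y)" by (simp add: J_def e_def f0_def)
  show "norm J \<le> 2 * schwartz_norm 4 \<phi> * I"
    unfolding J I_def Q_def[symmetric] using b0
    by (intro integral_bound_inverse_1_plus_square(2) continuous_intros cont ce) (simp add: norm_mult ne)
  define g0 where "g0 y = f1 y + 2 * \<i> * a * y * f0 y" for y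
  define g1 where "g1 y = f2 y + 2 * \<i> * a * (f0 y + y * f1 y)" for y
  have dg: "(g0 has_vector_derivative g1 y) (at y)" for y
  proof -
    have "((\<lambda>y. of_real y * f0 y) has_vector_derivative of_real y * f1 y + 1 * f0 y) (at y)"
      using has_vector_derivative_mult[OF has_vector_derivative_of_real[OF DERIV_ident[of "at y"]] d0] by simp
    from has_vector_derivative_add[OF d1 has_vector_derivative_mult_right[OF this, of "2 * \<i> * a"]]
    show ?thesis unfolding g0_def[abs_def] g1_def by (simp add: algebra_simps)
  qed
  have cg0: "continuous_on UNIV g0" unfolding g0_def[abs_def] by (intro continuous_intros cont)
  have cg1: "continuous_on UNIV g1" unfolding g1_def[abs_def] by (intro continuous_intros cont)
  have bg0: "norm (g0 y) \<le> (2 + 4 * \<bar>a\<bar>) * Q * inverse (1 + y\<^sup>2)" for y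
  proof (rule div)
    have "norm (g0 y) \<le> norm (f1 y) + 2 * \<bar>a\<bar> * (\<bar>y\<bar> * norm (f0 y))"
      unfolding g0_def by (rule order_trans[OF norm_triangle_ineq]) (simp add: norm_mult)
    then have "(1 + y\<^sup>2) * norm (g0 y) \<le> (1 + y\<^sup>2) * (norm (f1 y) + 2 * \<bar>a\<bar> * (\<bar>y\<bar> * norm (f0 y)))"
      by (rule mult_left_mono) simp
    also have "\<dots> = \<bar>y\<bar> ^ 0 * norm (f1 y) + \<bar>y\<bar> ^ 2 * norm (f1 y) +
        2 * \<bar>a\<bar> * (\<bar>y\<bar> ^ 1 * norm (f0 y) + \<bar>y\<bar> ^ 3 * norm (f0 y))"
      by (simp add: algebra_simps power2_eq_square power3_eq_cube)
    also have "\<dots> \<le> Q + Q + 2 * \<bar>a\<bar> * (Q + Q)"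
      by (intro add_mono mult_left_mono q0 q1) auto
    finally show "(1 + y\<^sup>2) * norm (g0 y) \<le> (2 + 4 * \<bar>a\<bar>) * Q" by (simp add: algebra_simps)
  qed
  define h where "h y = g1 y + 2 * \<i> * a * y * g0 y" for y
  have bh: "norm (h y) \<le> (2 + 12 * \<bar>a\<bar> + 8 * a\<^sup>2) * Q * inverse (1 + y\<^sup>2)" for y
  proof (rule div)
    have h: "h y = f2 y + 2 * \<i> * a * f0 y + 4 * \<i> * a * (y * f1 y) + (- 4 * (of_real a)\<^sup>2 * (y\<^sup>2 * f0 y))"
      by (simp add: h_def g0_def g1_def algebra_simps power2_eq_square)
    have "norm (h y) \<le> norm (f2 y) + 2 * \<bar>a\<bar> * norm (f0 y) + 4 * \<bar>a\<bar> * (\<bar>y\<bar> * norm (f1 y)) +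
        4 * a\<^sup>2 * (y\<^sup>2 * norm (f0 y))"
      unfolding h by (intro order_trans[OF norm_triangle_ineq] add_mono) (auto simp: norm_mult norm_power)
    then have "(1 + y\<^sup>2) * norm (h y) \<le> (1 + y\<^sup>2) * (norm (f2 y) + 2 * \<bar>a\<bar> * norm (f0 y) +
        4 * \<bar>a\<bar> * (\<bar>y\<bar> * norm (f1 y)) + 4 * a\<^sup>2 * (y\<^sup>2 * norm (f0 y)))"
      by (rule mult_left_mono) simp
    also have "\<dots> = \<bar>y\<bar> ^ 0 * norm (f2 y) + \<bar>y\<bar> ^ 2 * norm (f2 y) +
        2 * \<bar>a\<bar> * (\<bar>y\<bar> ^ 0 * norm (f0 y) + \<bar>y\<bar> ^ 2 * norm (f0 y)) +
        4 * \<bar>a\<bar> * (\<bar>y\<bar> ^ 1 * norm (f1 y) + \<bar>y\<bar> ^ 3 * norm (f1 y)) +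
        4 * a\<^sup>2 * (\<bar>y\<bar> ^ 2 * norm (f0 y) + \<bar>y\<bar> ^ 4 * norm (f0 y))"
      by (simp add: algebra_simps power2_eq_square power3_eq_cube power4_eq_xxxx)
    also have "\<dots> \<le> Q + Q + 2 * \<bar>a\<bar> * (Q + Q) + 4 * \<bar>a\<bar> * (Q + Q) + 4 * a\<^sup>2 * (Q + Q)"
      by (intro add_mono mult_left_mono q0 q1 q2) auto
    finally show "(1 + y\<^sup>2) * norm (h y) \<le> (2 + 12 * \<bar>a\<bar> + 8 * a\<^sup>2) * Q" by (simp add: algebra_simps)
  qed
  have ch: "continuous_on UNIV h" unfolding h_def[abs_def] by (intro continuous_intros cg0 cg1)
  have "\<i> * l * J = - (LINT y|lborel. e y * g0 y)"
    unfolding J e_def g0_def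
    by (rule chirp_by_parts[OF d0 cont(2) b0 bg0[unfolded g0_def]])
  moreover have "\<i> * l * (LINT y|lborel. e y * g0 y) = - (LINT y|lborel. e y * h y)"
    unfolding e_def h_def
    by (rule chirp_by_parts[OF dg cg1 bg0 bh[unfolded h_def]])
  ultimately have "(\<i> * l) * (\<i> * l * J) = (LINT y|lborel. e y * h y)" by simp
  then have "norm ((\<i> * l) * (\<i> * l * J)) = norm (LINT y|lborel. e y * h y)" by simp
  then have "l\<^sup>2 * norm J = norm (LINT y|lborel. e y * h y)"
    by (simp add: norm_mult power2_eq_square)
  also have "\<dots> \<le> (2 + 12 * \<bar>a\<bar> + 8 * a\<^sup>2) * Q * I"
    unfolding I_def using bh
    by (intro integral_bound_inverse_1_plus_square(2) continuous_intros ch ce) (simp add: norm_mult ne)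
  finally show "l\<^sup>2 * norm J \<le> (2 + 12 * \<bar>a\<bar> + 8 * a\<^sup>2) * schwartz_norm 4 \<phi> * I"
    by (simp add: Q_def)
qed

text \<open>The part of the kernel's phase that depends on \<open>x\<close> alone comes out of the integral; what remains
  is a Fourier integral of \<open>f\<close> multiplied by a chirp.\<close>

lemma frac_fourier_base_chirp:
  assumes "\<alpha> \<noteq> 0" and s: "s = sin (pi * \<alpha> / 2)" "s \<noteq> 0" and c: "c = cos (pi * \<alpha> / 2)"
  shows "frac_fourier_base \<alpha> f x = 1 / csqrt (\<i> * of_real s) * exp (\<i> * of_real (pi * c / s * x\<^sup>2)) *
    (LINT y|lborel. exp (\<i> * of_real (pi * c / s * y\<^sup>2 + (- 2 * pi * x / s) * y)) * f y)"
proof -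
  have e: "exp (pi * \<i> / sin (pi * \<alpha> / 2) * (cos (pi * \<alpha> / 2) * (x\<^sup>2 + y\<^sup>2) - 2 * x * y)) * f y =
      exp (\<i> * of_real (pi * c / s * x\<^sup>2)) *
      (exp (\<i> * of_real (pi * c / s * y\<^sup>2 + (- 2 * pi * x / s) * y)) * f y)" for y
  proof -
    have "complex_of_real pi * \<i> / s * of_real (c * (x\<^sup>2 + y\<^sup>2) - 2 * x * y) =
        \<i> * of_real (pi / s * (c * (x\<^sup>2 + y\<^sup>2) - 2 * x * y))" by simp
    also have "pi / s * (c * (x\<^sup>2 + y\<^sup>2) - 2 * x * y) =
        pi * c / s * x\<^sup>2 + (pi * c / s * y\<^sup>2 + (- 2 * pi * x / s) * y)"
      by (simp add: algebra_simps diff_divide_distrib add_divide_distrib)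
    finally show ?thesis
      unfolding s(1)[symmetric] c[symmetric]
      by (simp only: of_real_add distrib_left exp_add mult.assoc)
  qed
  show ?thesis
    using assms(1) unfolding frac_fourier_base_def e
    by (simp add: s(1)[symmetric] c[symmetric])
qed

lemma sin_half_pi_nonzero:
  assumes "\<bar>\<alpha>\<bar> < 2" "\<alpha> \<noteq> 0"
  shows "sin (pi * \<alpha> / 2) \<noteq> 0"
proof -
  have "sin (pi * \<bar>\<alpha>\<bar> / 2) > 0"
    using assms by (intro sin_gt_zero) auto
  then show ?thesis by (cases "\<alpha> \<ge> 0") auto
qed

text \<open>Decay of order two, uniformly on Schwartz-bounded sets, is what makes the sum over the lattice
  absolutely convergent and continuous in \<open>\<phi>\<close>.\<close>

lemma frac_fourier_base_decay:
  assumes "\<bar>\<alpha>\<bar> < 2"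
  obtains C where "\<And>\<phi> x. \<phi> \<in> schwartz \<Longrightarrow>
    norm (frac_fourier_base \<alpha> \<phi> x) \<le> C * schwartz_norm 4 \<phi> * inverse (1 + x\<^sup>2)"
proof (cases "\<alpha> = 0")
  case True
  have "norm (\<phi> x) \<le> 2 * schwartz_norm 4 \<phi> * inverse (1 + x\<^sup>2)" if "\<phi> \<in> schwartz" for \<phi> x
    using schwartz_norm_upper[OF that, of 0 4 0 x] schwartz_norm_upper[OF that, of 2 4 0 x]
    by (simp add: field_simps add_pos_nonneg)
  then show ?thesis using that[of 2] True by (simp add: frac_fourier_base_def)
next
  case False
  define s where "s = sin (pi * \<alpha> / 2)"
  define c where "c = cos (pi * \<alpha> / 2)"
  define a where "a = pi * c / s"
  define K where "K = norm (1 / csqrt (\<i> * of_real s))"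
  define I where "I = (LINT x|lborel. inverse (1 + x\<^sup>2 :: real))"
  have s: "s \<noteq> 0" unfolding s_def using assms False by (rule sin_half_pi_nonzero)
  define C where "C = K * (2 + (s / (2 * pi))\<^sup>2 * (2 + 12 * \<bar>a\<bar> + 8 * a\<^sup>2)) * I"
  have "norm (frac_fourier_base \<alpha> \<phi> x) \<le> C * schwartz_norm 4 \<phi> * inverse (1 + x\<^sup>2)"
    if \<phi>: "\<phi> \<in> schwartz" for \<phi> x
  proof -
    define l where "l = - 2 * pi * x / s"
    define J where "J = (LINT y|lborel. exp (\<i> * of_real (a * y\<^sup>2 + l * y)) * \<phi> y)"
    define Q where "Q = schwartz_norm 4 \<phi>"
    have n: "norm (frac_fourier_base \<alpha> \<phi> x) = K * norm J"
      unfolding frac_fourier_base_chirp[OF False s_def s c_def] J_def K_def a_def l_def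
      by (simp only: norm_mult norm_exp_i_times mult_1_right)
    have 1: "norm J \<le> 2 * Q * I" and 2: "l\<^sup>2 * norm J \<le> (2 + 12 * \<bar>a\<bar> + 8 * a\<^sup>2) * Q * I"
      unfolding J_def Q_def I_def by (rule chirp_transform_decay[OF \<phi>])+
    have x: "x\<^sup>2 = (s / (2 * pi))\<^sup>2 * l\<^sup>2"
      using s by (simp add: l_def field_simps)
    have "(1 + x\<^sup>2) * norm J = norm J + (s / (2 * pi))\<^sup>2 * (l\<^sup>2 * norm J)"
      unfolding x by (simp add: algebra_simps)
    also have "\<dots> \<le> 2 * Q * I + (s / (2 * pi))\<^sup>2 * ((2 + 12 * \<bar>a\<bar> + 8 * a\<^sup>2) * Q * I)"
      using 1 2 by (intro add_mono mult_left_mono) auto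
    finally have "K * ((1 + x\<^sup>2) * norm J) \<le> K * (2 * Q * I + (s / (2 * pi))\<^sup>2 * ((2 + 12 * \<bar>a\<bar> + 8 * a\<^sup>2) * Q * I))"
      by (rule mult_left_mono) (simp add: K_def)
    also have "\<dots> = C * Q" by (simp add: C_def algebra_simps)
    finally have "(1 + x\<^sup>2) * norm (frac_fourier_base \<alpha> \<phi> x) \<le> C * Q"
      unfolding n by (simp add: algebra_simps)
    then show ?thesis unfolding Q_def by (simp add: field_simps add_pos_nonneg)
  qed
  then show ?thesis using that by blast
qed


section \<open>The transformed comb as a tempered distribution\<close>

text \<open>Up to a nonzero constant this is the transform of the comb, for exponents in the range of the
  integral formula.\<close>

definition comb_transform :: "real \<Rightarrow> real \<Rightarrow> functional" where
  "comb_transform \<alpha> r \<phi> = (\<Sum>\<^sub>\<infinity>k::int. frac_fourier_base \<alpha> \<phi> (r * of_int k))"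

lemma summable_on_int_lattice:
  fixes r :: real
  assumes "r \<noteq> 0"
  shows "(\<lambda>k::int. inverse (1 + (r * of_int k)\<^sup>2)) summable_on UNIV"
proof -
  let ?g = "\<lambda>k::int. inverse (1 + (r * of_int k)\<^sup>2)"
  have "summable (\<lambda>n::nat. inverse (1 + (r * real n)\<^sup>2))"
  proof (rule summable_comparison_test)
    show "summable (\<lambda>n. inverse (r\<^sup>2) * inverse (real n ^ 2))"
      by (intro summable_mult inverse_power_summable) auto
    have "norm (inverse (1 + (r * real n)\<^sup>2)) \<le> inverse (r\<^sup>2) * inverse (real n ^ 2)" if "n \<ge> 1" for n
    proof -
      have "inverse (1 + (r * real n)\<^sup>2) \<le> inverse ((r * real n)\<^sup>2)"
        using assms that by (intro le_imp_inverse_le) auto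
      then show ?thesis by (simp add: power_mult_distrib)
    qed
    then show "\<exists>N. \<forall>n\<ge>N. norm (inverse (1 + (r * real n)\<^sup>2)) \<le> inverse (r\<^sup>2) * inverse (real n ^ 2)"
      by blast
  qed
  then have nat: "(\<lambda>n::nat. inverse (1 + (r * real n)\<^sup>2)) summable_on UNIV"
    by (intro norm_summable_imp_summable_on) simp
  have "?g summable_on range int"
    by (subst summable_on_reindex) (use nat in \<open>auto simp: o_def\<close>)
  moreover have "?g summable_on range (\<lambda>n. - int n)"
    by (subst summable_on_reindex) (use nat in \<open>auto simp: o_def inj_on_def\<close>)
  ultimately have "?g summable_on (range int \<union> range (\<lambda>n. - int n))"
    by (rule summable_on_union)
  moreover have "range int \<union> range (\<lambda>n. - int n) = UNIV"
    by (auto simp: image_iff) (metis int_cases2)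
  ultimately show ?thesis by simp
qed

lemma comb_transform_bound:
  assumes "\<bar>\<alpha>\<bar> < 2" "r \<noteq> 0"
  obtains C where
    "\<And>\<phi>. \<phi> \<in> schwartz \<Longrightarrow> (\<lambda>k::int. frac_fourier_base \<alpha> \<phi> (r * of_int k)) summable_on UNIV"
    "\<And>\<phi>. \<phi> \<in> schwartz \<Longrightarrow> norm (comb_transform \<alpha> r \<phi>) \<le> C * schwartz_norm 4 \<phi>"
proof -
  obtain C where C: "\<And>\<phi> x. \<phi> \<in> schwartz \<Longrightarrow>
      norm (frac_fourier_base \<alpha> \<phi> x) \<le> C * schwartz_norm 4 \<phi> * inverse (1 + x\<^sup>2)"
    using frac_fourier_base_decay[OF assms(1)] by blast
  define L where "L = (\<Sum>\<^sub>\<infinity>k::int. inverse (1 + (r * of_int k)\<^sup>2))"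
  have sm: "(\<lambda>k::int. B * inverse (1 + (r * of_int k)\<^sup>2)) summable_on UNIV" for B
    by (intro summable_on_cmult_right summable_on_int_lattice assms)
  have abs: "(\<lambda>k::int. norm (frac_fourier_base \<alpha> \<phi> (r * of_int k))) summable_on UNIV" if "\<phi> \<in> schwartz" for \<phi>
    by (rule Infinite_Sum.abs_summable_on_comparison_test'[OF sm]) (rule C[OF that])
  show ?thesis
  proof (rule that[of "C * L"])
    fix \<phi> assume \<phi>: "\<phi> \<in> schwartz"
    show "(\<lambda>k::int. frac_fourier_base \<alpha> \<phi> (r * of_int k)) summable_on UNIV"
      by (rule abs_summable_summable[OF abs[OF \<phi>]])
    have "norm (comb_transform \<alpha> r \<phi>) \<le> (\<Sum>\<^sub>\<infinity>k::int. norm (frac_fourier_base \<alpha> \<phi> (r * of_int k)))"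
      unfolding comb_transform_def by (rule norm_infsum_bound[OF abs[OF \<phi>]])
    also have "\<dots> \<le> (\<Sum>\<^sub>\<infinity>k::int. C * schwartz_norm 4 \<phi> * inverse (1 + (r * of_int k)\<^sup>2))"
      by (rule infsum_mono[OF abs[OF \<phi>] sm C[OF \<phi>]])
    also have "\<dots> = C * L * schwartz_norm 4 \<phi>"
      by (simp add: infsum_cmult_right' L_def)
    finally show "norm (comb_transform \<alpha> r \<phi>) \<le> C * L * schwartz_norm 4 \<phi>" .
  qed
qed

lemma frac_fourier_base_linear:
  assumes "\<phi> \<in> schwartz" "\<psi> \<in> schwartz"
  shows "frac_fourier_base \<alpha> (\<lambda>x. a * \<phi> x + b * \<psi> x) x =
    a * frac_fourier_base \<alpha> \<phi> x + b * frac_fourier_base \<alpha> \<psi> x"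
proof -
  define K where "K y = exp (pi * \<i> / sin (pi * \<alpha> / 2) *
            (cos (pi * \<alpha> / 2) * (x\<^sup>2 + y\<^sup>2) - 2 * x * y))" for y :: real
  have [measurable]: "K \<in> borel_measurable borel"
    unfolding K_def[abs_def] by measurable
  have K1: "norm (K y) = 1" for y by (simp add: K_def)
  have int: "integrable lborel (\<lambda>y. K y * f y)" if "f \<in> schwartz" for f
  proof -
    note f = schwartz_integrable[OF that]
    have [measurable]: "f \<in> borel_measurable borel" using f by auto
    show ?thesis
      by (rule Bochner_Integration.integrable_bound[OF f]) (auto simp: norm_mult K1)
  qed
  have "(LINT y|lborel. K y * (a * \<phi> y + b * \<psi> y)) =
      (LINT y|lborel. a * (K y * \<phi> y) + b * (K y * \<psi> y))"
    by (simp add: algebra_simps)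
  also have "\<dots> = a * (LINT y|lborel. K y * \<phi> y) + b * (LINT y|lborel. K y * \<psi> y)"
    using int assms by simp
  finally have int: "(LINT y|lborel. K y * (a * \<phi> y + b * \<psi> y)) =
      a * (LINT y|lborel. K y * \<phi> y) + b * (LINT y|lborel. K y * \<psi> y)" .
  have "frac_fourier_base \<alpha> f x = (if \<alpha> = 0 then f x else
      1 / csqrt (\<i> * of_real (sin (pi * \<alpha> / 2))) * (LINT y|lborel. K y * f y))" for f
    by (simp add: frac_fourier_base_def K_def)
  then show ?thesis
    using int by (simp add: algebra_simps add_divide_distrib)
qed

lemma comb_transform_linear:
  assumes "\<bar>\<alpha>\<bar> < 2" "r \<noteq> 0" "\<phi> \<in> schwartz" "\<psi> \<in> schwartz"
  shows "comb_transform \<alpha> r (\<lambda>x. a * \<phi> x + b * \<psi> x) =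
    a * comb_transform \<alpha> r \<phi> + b * comb_transform \<alpha> r \<psi>"
proof -
  obtain C where "\<And>\<phi>. \<phi> \<in> schwartz \<Longrightarrow>
      (\<lambda>k::int. frac_fourier_base \<alpha> \<phi> (r * of_int k)) summable_on UNIV"
    using comb_transform_bound[OF assms(1,2)] by metis
  then show ?thesis
    unfolding comb_transform_def frac_fourier_base_linear[OF assms(3,4)]
    using assms by (simp add: infsum_add infsum_cmult_right' summable_on_cmult_right)
qed


section \<open>Heisenberg covariance\<close>

text \<open>The time-frequency shift by \<open>(a, b)\<close>. The phase \<open>-\<pi>ab\<close> is the symmetric normalization, in which
  linear symplectic maps act without an additional factor.\<close>

definition heisenberg :: "real \<Rightarrow> real \<Rightarrow> (real \<Rightarrow> complex) \<Rightarrow> real \<Rightarrow> complex" where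
  "heisenberg a b f x = exp (\<i> * of_real (pi * (2 * b * x - a * b))) * f (x - a)"

text \<open>The fractional Fourier transform rotates the time-frequency plane by the angle \<open>\<pi>\<alpha>/2\<close>. After the
  substitution \<open>y = a + z\<close> the two phases agree because the rotated shift \<open>(a', b')\<close> satisfies
  \<open>ca' - sb' = a\<close>.\<close>

lemma frac_fourier_base_heisenberg:
  assumes "\<bar>\<alpha>\<bar> < 2"
  defines "s \<equiv> sin (pi * \<alpha> / 2)" and "c \<equiv> cos (pi * \<alpha> / 2)"
  shows "frac_fourier_base \<alpha> (heisenberg a b f) x =
    heisenberg (a * c + b * s) (b * c - a * s) (frac_fourier_base \<alpha> f) x"
proof (cases "\<alpha> = 0")
  case False
  define a' where "a' = a * c + b * s"
  define b' where "b' = b * c - a * s"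
  define q where "q = (\<lambda>x y. pi / s * (c * (x\<^sup>2 + y\<^sup>2) - 2 * x * y))"
  have s: "s \<noteq> 0" unfolding s_def using assms(1) False by (rule sin_half_pi_nonzero)
  have base: "frac_fourier_base \<alpha> f x = 1 / csqrt (\<i> * of_real s) * (LINT y|lborel. exp (\<i> * of_real (q x y)) * f y)"
    for f x
    using False by (simp add: frac_fourier_base_def s_def c_def q_def mult_ac)
  have sc: "s\<^sup>2 + c\<^sup>2 = 1" by (simp add: s_def c_def)
  have "c * a' - s * b' = a * (s\<^sup>2 + c\<^sup>2)"
    by (simp add: a'_def b'_def algebra_simps power2_eq_square)
  then have h: "c * a' - s * b' = a" by (simp add: sc)
  have phase: "q x (a + z) + pi * (2 * b * (a + z) - a * b) = pi * (2 * b' * x - a' * b') + q (x - a') z" for z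
  proof -
    have "c * (x\<^sup>2 + (a + z)\<^sup>2) - 2 * x * (a + z) + s * (2 * b * (a + z) - a * b)
        = c * x\<^sup>2 + c * z\<^sup>2 - 2 * x * z + 2 * (a * c + b * s) * z - 2 * x * a + (a * c + b * s) * a"
      by (simp add: algebra_simps power2_eq_square)
    also have "\<dots> = c * x\<^sup>2 + c * z\<^sup>2 - 2 * x * z + 2 * a' * z - 2 * x * (c * a' - s * b') + a' * (c * a' - s * b')"
      unfolding a'_def[symmetric] h ..
    also have "\<dots> = s * (2 * b' * x - a' * b') + (c * ((x - a')\<^sup>2 + z\<^sup>2) - 2 * (x - a') * z)"
      by (simp add: algebra_simps power2_eq_square)
    finally have "pi / s * (c * (x\<^sup>2 + (a + z)\<^sup>2) - 2 * x * (a + z) + s * (2 * b * (a + z) - a * b)) =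
        pi / s * (s * (2 * b' * x - a' * b') + (c * ((x - a')\<^sup>2 + z\<^sup>2) - 2 * (x - a') * z))"
      by simp
    moreover have "pi / s * (X + s * Y) = pi / s * X + pi * Y" "pi / s * (s * Y + X) = pi * Y + pi / s * X" for X Y
      using s by (simp_all add: field_simps)
    ultimately show ?thesis by (simp only: q_def)
  qed
  have "(LINT y|lborel. exp (\<i> * of_real (q x y)) * heisenberg a b f y) =
      (LINT z|lborel. exp (\<i> * of_real (q x (a + z))) * heisenberg a b f (a + z))"
    using lborel_integral_real_affine[of 1 "\<lambda>y. exp (\<i> * of_real (q x y)) * heisenberg a b f y" a] by simp
  also have "\<dots> = (LINT z|lborel. exp (\<i> * of_real (pi * (2 * b' * x - a' * b'))) *
      (exp (\<i> * of_real (q (x - a') z)) * f z))"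
  proof (rule Bochner_Integration.integral_cong[OF refl])
    fix z
    have "exp (\<i> * of_real (q x (a + z))) * exp (\<i> * of_real (pi * (2 * b * (a + z) - a * b))) =
        exp (\<i> * of_real (pi * (2 * b' * x - a' * b'))) * exp (\<i> * of_real (q (x - a') z))"
      by (simp only: exp_add[symmetric] distrib_left[symmetric] of_real_add[symmetric] phase)
    then show "exp (\<i> * of_real (q x (a + z))) * heisenberg a b f (a + z) =
        exp (\<i> * of_real (pi * (2 * b' * x - a' * b'))) * (exp (\<i> * of_real (q (x - a') z)) * f z)"
      unfolding heisenberg_def by (simp only: mult.assoc[symmetric]) simp
  qed
  also have "\<dots> = exp (\<i> * of_real (pi * (2 * b' * x - a' * b'))) *
      (LINT z|lborel. exp (\<i> * of_real (q (x - a') z)) * f z)"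
    by (rule integral_mult_right_zero)
  finally show ?thesis
    unfolding base heisenberg_def a'_def[symmetric] b'_def[symmetric] by (simp only: mult_ac)
qed (simp add: frac_fourier_base_def heisenberg_def s_def c_def)

lemma exp_2pi_int: "exp (\<i> * of_real (2 * pi * of_int k)) = 1"
  using exp_integer_2pi[of "of_int k"] by (simp add: mult_ac)

text \<open>The comb is invariant under translation by \<open>r\<close> and modulation by \<open>1/r\<close>; its transform is
  therefore invariant, up to phases, under the rotated lattice. Indeed the transform carries the shift
  below to the shift by \<open>(mr, n/r)\<close>, which permutes the sampling points.\<close>

lemma comb_transform_heisenberg:
  fixes m n :: int
  assumes "\<bar>\<alpha>\<bar> < 2" "r \<noteq> 0"
  defines "s \<equiv> sin (pi * \<alpha> / 2)" and "c \<equiv> cos (pi * \<alpha> / 2)"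
  shows "comb_transform \<alpha> r
      (heisenberg (of_int m * r * c - of_int n * s / r) (of_int m * r * s + of_int n * c / r) f) =
    exp (- (\<i> * of_real (pi * of_int (m * n)))) * comb_transform \<alpha> r f"
proof -
  define a where "a = m * r * c - n * s / r"
  define b where "b = m * r * s + n * c / r"
  have sc: "c\<^sup>2 + s\<^sup>2 = 1" by (simp add: s_def c_def)
  have "a * c + b * s = m * r * (c\<^sup>2 + s\<^sup>2)" "b * c - a * s = n / r * (c\<^sup>2 + s\<^sup>2)"
    by (simp_all add: a_def b_def algebra_simps power2_eq_square)
  then have ab: "a * c + b * s = m * r" "b * c - a * s = n / r" by (simp_all add: sc)
  have "frac_fourier_base \<alpha> (heisenberg a b f) (r * of_int k) =
      exp (- (\<i> * of_real (pi * of_int (m * n)))) * frac_fourier_base \<alpha> f (r * of_int (k - m))" for k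
  proof -
    have "pi * (2 * (n / r) * (r * of_int k) - m * r * (n / r)) = 2 * pi * of_int (n * k) + - (pi * of_int (m * n))"
      using assms(2) by (simp add: field_simps)
    then have "exp (\<i> * of_real (pi * (2 * (n / r) * (r * of_int k) - m * r * (n / r)))) =
        exp (- (\<i> * of_real (pi * of_int (m * n))))"
      by (simp only: of_real_add distrib_left exp_add exp_2pi_int of_real_minus mult_minus_right mult_1_left)
    moreover have "r * of_int k - m * r = r * of_int (k - m)" by (simp add: algebra_simps)
    ultimately show ?thesis
      unfolding frac_fourier_base_heisenberg[OF assms(1)] s_def[symmetric] c_def[symmetric] ab heisenberg_def
      by simp
  qed
  then have "comb_transform \<alpha> r (heisenberg a b f) =
      exp (- (\<i> * of_real (pi * of_int (m * n)))) * (\<Sum>\<^sub>\<infinity>k::int. frac_fourier_base \<alpha> f (r * of_int (k - m)))"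
    unfolding comb_transform_def by (simp only: infsum_cmult_right')
  also have "(\<Sum>\<^sub>\<infinity>k::int. frac_fourier_base \<alpha> f (r * of_int (k - m))) = comb_transform \<alpha> r f"
    unfolding comb_transform_def
    by (rule infsum_reindex_bij_betw) (rule bij_betwI[of _ _ _ "\<lambda>k. k + m"], auto)
  finally show ?thesis by (simp add: a_def b_def)
qed


section \<open>Test functions\<close>

lemma nth_vderiv_zero: "nth_vderiv n (\<lambda>x. 0) = (\<lambda>x. 0)"
  by (induction n) (auto simp: nth_vderiv_Suc)

lemma smooth_on_nth_vderiv: "smooth_on S f \<Longrightarrow> smooth_on S (nth_vderiv n f)"
  by (induction n) (auto simp: nth_vderiv_Suc intro: smooth_on_vderiv)

lemma compact_support_imp_schwartz:
  assumes "smooth_on UNIV f" "compact (closure {x. f x \<noteq> 0})"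
  shows "f \<in> schwartz"
proof -
  let ?K = "closure {x. f x \<noteq> 0}"
  have "bounded (range (\<lambda>x. x ^ m *\<^sub>R nth_vderiv n f x))" for m n
  proof -
    have "nth_vderiv n f x = 0" if "x \<notin> ?K" for x
    proof -
      have "nth_vderiv n f x = nth_vderiv n (\<lambda>x. 0) x"
      proof (rule nth_vderiv_cong_open)
        show "open (- ?K)" by (rule open_Compl[OF closed_closure])
        show "f y = 0" if "y \<in> - ?K" for y
          using that closure_subset[of "{x. f x \<noteq> 0}"] by auto
        show "x \<in> - ?K" using that by simp
      qed
      then show ?thesis by (simp add: nth_vderiv_zero)
    qed
    then have "range (\<lambda>x. x ^ m *\<^sub>R nth_vderiv n f x) \<subseteq> insert 0 ((\<lambda>x. x ^ m *\<^sub>R nth_vderiv n f x) ` ?K)"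
      by force
    moreover have "continuous_on ?K (nth_vderiv n f)"
      by (rule continuous_on_subset[OF smooth_on_continuous[OF smooth_on_nth_vderiv[OF assms(1)]]]) simp
    then have "compact ((\<lambda>x. x ^ m *\<^sub>R nth_vderiv n f x) ` ?K)"
      by (intro compact_continuous_image assms continuous_intros)
    ultimately show ?thesis
      by (meson bounded_insert bounded_subset compact_imp_bounded)
  qed
  then show ?thesis using assms(1) by (auto simp: schwartz_def smooth_iff)
qed

lemma test_functions_on_schwartz: "test_functions_on U \<subseteq> schwartz"
  by (auto simp: test_functions_on_def smooth_iff intro: compact_support_imp_schwartz)

lemma test_functions_onI:
  assumes "smooth_on UNIV f" "\<And>x. x \<notin> {l..u} \<Longrightarrow> f x = 0" "{l..u} \<subseteq> U"
  shows "f \<in> test_functions_on U"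
proof -
  have K: "closure {x. f x \<noteq> 0} \<subseteq> {l..u}"
    using assms(2) by (intro closure_minimal) (blast, simp)
  then have "compact (closure {x. f x \<noteq> 0})"
    by (metis closed_closure compact_Icc compact_Int_closed inf.absorb_iff2)
  then show ?thesis using assms K by (auto simp: test_functions_on_def smooth_iff)
qed

lemma smooth_on_chirp: "smooth_on UNIV (\<lambda>x. exp (\<i> * of_real (a * x\<^sup>2 + b * x + d)))"
proof -
  have "smooth_on UNIV (\<lambda>x. exp (\<i> * of_real a * (of_real x * of_real x) + \<i> * of_real b * of_real x + \<i> * of_real d))"
    by (intro smooth_on_exp smooth_on_add smooth_on_mult smooth_on_of_real smooth_on_const) auto
  then show ?thesis by (simp add: algebra_simps power2_eq_square)
qed

lemma smooth_on_heisenberg: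
  assumes "smooth_on UNIV f"
  shows "smooth_on UNIV (heisenberg a b f)"
proof -
  have "smooth_on UNIV (\<lambda>x. exp (\<i> * of_real (0 * x\<^sup>2 + (2 * pi * b) * x + (- pi * a * b))) * f (1 * x + - a))"
    by (intro smooth_on_mult smooth_on_chirp smooth_on_affine assms) auto
  then show ?thesis by (simp add: heisenberg_def[abs_def] algebra_simps)
qed


section \<open>The dependent case\<close>

text \<open>A dependence between \<open>rc\<close> and \<open>s/r\<close> is a nonzero vector of the rotated lattice whose translation
  part vanishes; its modulation part is then nonzero.\<close>

lemma dependent_modulation:
  assumes "\<bar>\<alpha>\<bar> < 2" "r > 0"
    and "int_lin_dependent (r * cos (pi * \<alpha> / 2)) (1 / r * sin (pi * \<alpha> / 2))"
  obtains b where "b \<noteq> 0" "\<And>f. comb_transform \<alpha> r (\<lambda>x. exp (\<i> * of_real (2 * pi * b * x)) * f x) = comb_transform \<alpha> r f"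
proof -
  define s where "s = sin (pi * \<alpha> / 2)"
  define c where "c = cos (pi * \<alpha> / 2)"
  obtain M N :: int where MN: "(M, N) \<noteq> (0, 0)" "of_int M * (r * c) + of_int N * (1 / r * s) = 0"
    using assms(3) unfolding int_lin_dependent_def s_def c_def by blast
  \<comment> \<open>Doubling the vector makes \<open>mn\<close> even and so removes the sign \<open>(-1)\<^sup>m\<^sup>n\<close>.\<close>
  define m n where "m = 2 * M" and "n = - 2 * N"
  define a where "a = m * r * c - n * s / r"
  define b where "b = m * r * s + n * c / r"
  have "a = 2 * (of_int M * (r * c) + of_int N * (1 / r * s))"
    by (simp add: a_def m_def n_def algebra_simps)
  then have a: "a = 0" using MN(2) by simp
  have "b \<noteq> 0"
  proof
    assume b: "b = 0"
    have sc: "c\<^sup>2 + s\<^sup>2 = 1" by (simp add: s_def c_def)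
    have "a * c + b * s = m * r * (c\<^sup>2 + s\<^sup>2)" "b * c - a * s = n / r * (c\<^sup>2 + s\<^sup>2)"
      by (simp_all add: a_def b_def algebra_simps power2_eq_square)
    then have "m * r = 0" "n / r = 0" unfolding a b sc by simp_all
    then show False using MN(1) assms(2) by (simp add: m_def n_def)
  qed
  moreover have "comb_transform \<alpha> r (\<lambda>x. exp (\<i> * of_real (2 * pi * b * x)) * f x) = comb_transform \<alpha> r f" for f
  proof -
    have "heisenberg a b f = (\<lambda>x. exp (\<i> * of_real (2 * pi * b * x)) * f x)"
      by (simp add: heisenberg_def[abs_def] a mult_ac)
    moreover have "exp (- (\<i> * of_real (pi * of_int (m * n)))) = 1"
    proof -
      have "- (\<i> * of_real (pi * of_int (m * n))) = \<i> * of_real (2 * pi * of_int (2 * M * N))"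
        by (simp add: m_def n_def)
      then show ?thesis by (simp only: exp_2pi_int)
    qed
    ultimately show ?thesis
      using comb_transform_heisenberg[OF assms(1), of r m n f] assms(2)
      unfolding s_def[symmetric] c_def[symmetric] a_def[symmetric] b_def[symmetric] by simp
  qed
  ultimately show ?thesis using that by blast
qed

lemma exp_2pi_eq_1_iff: "exp (\<i> * of_real (2 * pi * x)) = 1 \<longleftrightarrow> x \<in> \<int>"
proof
  assume "exp (\<i> * of_real (2 * pi * x)) = 1"
  then obtain n :: int where "Im (\<i> * of_real (2 * pi * x)) = of_int (2 * n) * pi"
    unfolding exp_eq_1 by blast
  then have "x = of_int n" by simp
  then show "x \<in> \<int>" by simp
qed (auto elim!: Ints_cases simp: exp_2pi_int simp del: of_real_mult)

lemma int_multiples_closed: "closed {x::real. b * x \<in> \<int>}"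
proof -
  have "closed ((\<lambda>x. b * x) -` \<int>)"
    by (intro continuous_closed_vimage closed_Ints) (auto intro!: continuous_intros)
  then show ?thesis by (simp add: vimage_def)
qed

lemma int_multiples_discrete:
  assumes "b \<noteq> 0"
  shows "discrete {x::real. b * x \<in> \<int>}"
proof (rule uniform_discrete_imp_discrete)
  have "x = y" if xy: "b * x \<in> \<int>" "b * y \<in> \<int>" "dist x y < 1 / \<bar>b\<bar>" for x y
  proof -
    have "\<bar>b * x - b * y\<bar> < 1"
    proof -
      have "\<bar>b * x - b * y\<bar> = \<bar>b\<bar> * dist x y"
        by (simp add: dist_real_def abs_mult flip: right_diff_distrib)
      also have "\<dots> < \<bar>b\<bar> * (1 / \<bar>b\<bar>)"
        using xy(3) assms by (intro mult_strict_left_mono) auto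
      finally show ?thesis using assms by simp
    qed
    moreover obtain i j :: int where "b * x = i" "b * y = j" using xy(1,2) by (metis Ints_cases)
    ultimately have "i = j" by linarith
    then have "b * x = b * y" using \<open>b * x = i\<close> \<open>b * y = j\<close> by simp
    then show ?thesis using assms by simp
  qed
  then show "uniform_discrete {x::real. b * x \<in> \<int>}"
    using assms unfolding uniform_discrete_def by (intro exI[of _ "1 / \<bar>b\<bar>"]) auto
qed

text \<open>If \<open>u\<close> is invariant under multiplication by \<open>E(x) = e\<^sup>2\<^sup>\<pi>\<^sup>i\<^sup>b\<^sup>x\<close>, then \<open>(E - 1)u = 0\<close>, and away from the
  zeros of \<open>E - 1\<close> every test function is a multiple \<open>(E - 1)\<psi>\<close>.\<close>

lemma comb_transform_vanishes_off_lattice: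
  assumes "\<bar>\<alpha>\<bar> < 2" "r \<noteq> 0"
    and inv: "\<And>f. comb_transform \<alpha> r (\<lambda>x. exp (\<i> * of_real (2 * pi * b * x)) * f x) = comb_transform \<alpha> r f"
    and \<phi>: "\<phi> \<in> test_functions_on (- {x. b * x \<in> \<int>})"
  shows "comb_transform \<alpha> r \<phi> = 0"
proof -
  define U where "U = - {x. b * x \<in> \<int>}"
  define K where "K = closure {x. \<phi> x \<noteq> 0}"
  define E where "E x = exp (\<i> * of_real (2 * pi * b * x))" for x
  have E1: "E x = 1 \<longleftrightarrow> x \<notin> U" for x
    using exp_2pi_eq_1_iff[of "b * x"] by (simp add: E_def U_def mult_ac)
  have U: "open U" unfolding U_def using int_multiples_closed by (simp add: open_Compl)
  have sm: "smooth_on UNIV \<phi>" and K: "compact K" "K \<subseteq> U"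
    using \<phi> by (auto simp: test_functions_on_def smooth_iff K_def U_def)
  have zero: "\<phi> x = 0" if "x \<notin> K" for x
    using that closure_subset[of "{x. \<phi> x \<noteq> 0}"] unfolding K_def by auto
  \<comment> \<open>Where \<open>E = 1\<close> this is \<open>0\<close>, consistently with \<open>\<phi> = 0\<close> near these points.\<close>
  define \<psi> where "\<psi> x = inverse (E x - 1) * \<phi> x" for x
  have smE: "smooth_on UNIV E"
    using smooth_on_chirp[of 0 "2 * pi * b" 0] by (simp add: E_def[abs_def])
  have "smooth_on U \<psi>"
    unfolding \<psi>_def[abs_def] using U E1 sm smE
    by (intro smooth_on_mult smooth_on_inverse smooth_on_diff smooth_on_const) (auto intro: smooth_on_subset)
  moreover have "smooth_on (- K) \<psi>"
  proof -
    have "open (- K)" unfolding K_def by (rule open_Compl[OF closed_closure])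
    then show ?thesis
      using smooth_on_cong[of "- K" \<psi> "\<lambda>x. 0"] smooth_on_const zero by (simp add: \<psi>_def)
  qed
  ultimately have "smooth_on (U \<union> - K) \<psi>" by (rule smooth_on_Un)
  moreover have "U \<union> - K = UNIV" using K by auto
  ultimately have sm\<psi>: "smooth_on UNIV \<psi>" by simp
  have "closure {x. \<psi> x \<noteq> 0} \<subseteq> K"
    unfolding K_def by (rule closure_mono) (auto simp: \<psi>_def)
  then have c\<psi>: "compact (closure {x. \<psi> x \<noteq> 0})"
    using K(1) by (metis closed_closure compact_Int_closed inf.absorb_iff2)
  have S: "\<psi> \<in> schwartz" "(\<lambda>x. E x * \<psi> x) \<in> schwartz"
  proof -
    show "\<psi> \<in> schwartz" by (rule compact_support_imp_schwartz[OF sm\<psi> c\<psi>])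
    have "{x. E x * \<psi> x \<noteq> 0} = {x. \<psi> x \<noteq> 0}" by (simp add: E_def)
    then show "(\<lambda>x. E x * \<psi> x) \<in> schwartz"
      using sm\<psi> c\<psi> smE by (intro compact_support_imp_schwartz smooth_on_mult) auto
  qed
  have "\<phi> x = 1 * (E x * \<psi> x) + (-1) * \<psi> x" for x
  proof (cases "x \<in> U")
    case True
    then have "(E x - 1) * \<psi> x = \<phi> x" using E1[of x] by (simp add: \<psi>_def)
    then show ?thesis by (simp add: algebra_simps)
  next
    case False
    then have "\<phi> x = 0" using zero[of x] K(2) by blast
    then show ?thesis by (simp add: \<psi>_def)
  qed
  then have "comb_transform \<alpha> r \<phi> = comb_transform \<alpha> r (\<lambda>x. 1 * (E x * \<psi> x) + (-1) * \<psi> x)"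
    by presburger
  also have "\<dots> = 1 * comb_transform \<alpha> r (\<lambda>x. E x * \<psi> x) + (-1) * comb_transform \<alpha> r \<psi>"
    by (rule comb_transform_linear[OF assms(1,2) S(2,1)])
  also have "comb_transform \<alpha> r (\<lambda>x. E x * \<psi> x) = comb_transform \<alpha> r \<psi>"
    unfolding E_def by (rule inv)
  finally show ?thesis by simp
qed


section \<open>The independent case\<close>

lemma int_combinations_dense:
  fixes A B e t :: real
  assumes "\<not> int_lin_dependent A B" "e > 0"
  obtains m n :: int where "\<bar>m * A - n * B - t\<bar> < e"
proof -
  have ind: "m = 0 \<and> n = 0" if "of_int m * A + of_int n * B = 0" for m n :: int
    using assms(1) that unfolding int_lin_dependent_def by auto
  have B: "B \<noteq> 0" using ind[of 0 1] by auto
  have "A / B \<notin> \<rat>"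
  proof
    assume "A / B \<in> \<rat>"
    then obtain p q :: int where "q > 0" "A / B = of_int p / of_int q"
      by (meson Rats_cases')
    then have "of_int q * A + of_int (- p) * B = 0" using B by (simp add: field_simps)
    then show False using ind[of q "- p"] \<open>q > 0\<close> by simp
  qed
  moreover have "e / \<bar>B\<bar> > 0" using assms(2) B by simp
  ultimately obtain h k :: int where "\<bar>of_int k * (A / B) - of_int h - t / B\<bar> < e / \<bar>B\<bar>"
    using sequence_of_fractional_parts_is_dense by metis
  then have "\<bar>B\<bar> * \<bar>of_int k * (A / B) - of_int h - t / B\<bar> < e"
    using B by (simp add: field_simps)
  also have "\<bar>B\<bar> * \<bar>of_int k * (A / B) - of_int h - t / B\<bar> = \<bar>k * A - h * B - t\<bar>"
    unfolding abs_mult[symmetric] using B by (simp add: algebra_simps)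
  finally show ?thesis using that by blast
qed

lemma integrable_compact_support:
  fixes f :: "real \<Rightarrow> complex"
  assumes "continuous_on UNIV f" "\<And>x. x \<notin> {a..b} \<Longrightarrow> f x = 0"
  shows "integrable lborel f"
proof -
  have "set_integrable lborel {a..b} f"
    by (rule borel_integrable_atLeastAtMost') (use assms(1) continuous_on_subset in blast)
  moreover have "(\<lambda>x. indicator {a..b} x *\<^sub>R f x) = f"
    using assms(2) by (auto simp: indicator_def)
  ultimately show ?thesis by (simp add: set_integrable_def)
qed

lemma step_derivative_zero:
  fixes H :: "real \<Rightarrow> complex"
  assumes "\<And>x. x \<le> 0 \<Longrightarrow> H x = 0" "\<And>x. x \<ge> w \<Longrightarrow> H x = 1" "x \<notin> {0..w}"
  shows "vector_derivative H (at x) = 0"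
proof -
  consider "x < 0" | "x > w" using assms(3) by force
  then show ?thesis
  proof cases
    case 1
    then have "vector_derivative H (at x) = vector_derivative (\<lambda>x. 0 :: complex) (at x)"
      by (intro vector_derivative_cong_open[of "{..<0}"]) (auto simp: assms)
    then show ?thesis by simp
  next
    case 2
    then have "vector_derivative H (at x) = vector_derivative (\<lambda>x. 1 :: complex) (at x)"
      by (intro vector_derivative_cong_open[of "{w<..}"]) (auto simp: assms)
    then show ?thesis by simp
  qed
qed

text \<open>The difference of a smooth step and its translate by \<open>p\<close> is a bump whose \<open>p\<close>-periodization is
  constant, so its Fourier transform vanishes at the nonzero multiples of \<open>1/p\<close>. Integration by parts
  shows this without series: the right-hand side is zero as soon as the antiderivative \<open>E\<close> is
  \<open>p\<close>-periodic, and \<open>E(y) = y\<close> gives the mean value.\<close>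

lemma integral_step_difference:
  fixes H E e :: "real \<Rightarrow> complex"
  assumes H: "smooth_on UNIV H" "\<And>x. x \<le> 0 \<Longrightarrow> H x = 0" "\<And>x. x \<ge> w \<Longrightarrow> H x = 1"
    and E: "\<And>x. (E has_vector_derivative e x) (at x)" "continuous_on UNIV e"
    and "w > 0" "p > 0"
  defines "H' \<equiv> \<lambda>x. vector_derivative H (at x)"
  shows "(LINT y|lborel. e y * (H y - H (y - p))) = (LINT z|lborel. H' z * (E (z + p) - E z))"
proof -
  have dH: "(H has_vector_derivative H' x) (at x)" for x
    unfolding H'_def by (rule smooth_on_has_vderiv[OF H(1)]) simp
  have cH: "continuous_on UNIV H" "continuous_on UNIV H'"
    unfolding H'_def by (intro smooth_on_continuous H smooth_on_vderiv)+
  have cE: "continuous_on UNIV E"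
    using E(1) by (meson continuous_at_imp_continuous_on has_vector_derivative_continuous)
  have H'0: "H' x = 0" if "x \<notin> {0..w}" for x
    unfolding H'_def by (rule step_derivative_zero[OF H(2,3) that])
  define h where "h y = H y - H (y - p)" for y
  define h' where "h' y = H' y - H' (y - p)" for y
  have dh: "(h has_vector_derivative h' y) (at y)" for y
  proof -
    have "((\<lambda>y. y - p) has_vector_derivative 1) (at y)"
      unfolding has_real_derivative_iff_has_vector_derivative[symmetric]
      by (auto intro!: derivative_eq_intros)
    from vector_diff_chain_at[OF this dH]
    have "((\<lambda>y. H (y - p)) has_vector_derivative H' (y - p)) (at y)" by (simp add: o_def)
    then show ?thesis unfolding h_def[abs_def] h'_def by (intro has_vector_derivative_diff dH)
  qed
  have cHp: "continuous_on UNIV (\<lambda>y. H (y - p))" "continuous_on UNIV (\<lambda>y. H' (y - p))"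
    by (intro continuous_on_compose2[OF cH(1)] continuous_on_compose2[OF cH(2)] continuous_intros, simp)+
  have h0: "h y = 0" if "y \<le> 0 \<or> y > w + p" for y
    using that assms(6,7) by (auto simp: h_def H)
  have int1: "integrable lborel (\<lambda>y. e y * h y)"
    by (rule integrable_compact_support[of _ 0 "w + p"])
       (use h0 in \<open>auto simp: h_def intro!: continuous_intros E cH cHp\<close>)
  have int2: "integrable lborel (\<lambda>y. E y * H' y)"
    by (rule integrable_compact_support[of _ 0 w]) (auto simp: H'0 intro!: continuous_intros cE cH)
  have int3: "integrable lborel (\<lambda>y. E y * H' (y - p))"
    by (rule integrable_compact_support[of _ p "w + p"]) (auto simp: H'0 intro!: continuous_intros cE cHp)
  have int4: "integrable lborel (\<lambda>z. E (z + p) * H' z)"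
    using lborel_integrable_real_affine[OF int3, of 1 p] by (simp add: add.commute)
  have shift: "(LINT y|lborel. E y * H' (y - p)) = (LINT z|lborel. E (z + p) * H' z)"
    using lborel_integral_real_affine[of 1 "\<lambda>y. E y * H' (y - p)" p] by (simp add: add.commute)
  have Eh': "(\<lambda>y. E y * h' y) = (\<lambda>y. E y * H' y - E y * H' (y - p))"
    by (simp add: h'_def algebra_simps)
  have "(LINT y|lborel. E y * h' y + e y * h y) = 0 - 0"
  proof (rule integral_vector_derivative_real_line)
    show "((\<lambda>y. E y * h y) has_vector_derivative E y * h' y + e y * h y) (at y)" for y
      by (rule has_vector_derivative_mult[OF E(1) dh])
    show "continuous_on UNIV (\<lambda>y. E y * h' y + e y * h y)"
      unfolding h_def h'_def by (intro continuous_intros cE E cH cHp)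
    show "integrable lborel (\<lambda>y. E y * h' y + e y * h y)"
      using int1 int2 int3 unfolding Eh' by (intro Bochner_Integration.integrable_add) (simp_all add: Eh')
    show "((\<lambda>y. E y * h y) \<longlongrightarrow> 0) at_bot"
      by (rule tendsto_eventually, rule eventually_mono[OF eventually_le_at_bot[of 0]]) (simp add: h0)
    show "((\<lambda>y. E y * h y) \<longlongrightarrow> 0) at_top"
      by (rule tendsto_eventually, rule eventually_mono[OF eventually_gt_at_top[of "w + p"]]) (simp add: h0)
  qed
  moreover have "integrable lborel (\<lambda>y. E y * h' y)" using int2 int3 unfolding Eh' by simp
  ultimately have "(LINT y|lborel. e y * h y) = - (LINT y|lborel. E y * h' y)"
    using int1 by (simp add: eq_neg_iff_add_eq_0 add.commute)
  also have "\<dots> = (LINT z|lborel. E (z + p) * H' z) - (LINT y|lborel. E y * H' y)"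
    unfolding Eh' using int2 int3 shift by simp
  also have "\<dots> = (LINT z|lborel. E (z + p) * H' z - E z * H' z)"
    using int2 int4 by simp
  finally show ?thesis by (simp add: h_def algebra_simps)
qed

lemma integral_step_derivative:
  assumes H: "smooth_on UNIV H" "\<And>x. x \<le> 0 \<Longrightarrow> H x = 0" "\<And>x. x \<ge> w \<Longrightarrow> H x = 1"
  shows "(LINT y|lborel. vector_derivative H (at y)) = 1"
proof -
  let ?H' = "\<lambda>x. vector_derivative H (at x)"
  have "?H' x = 0" if "x \<notin> {0..w}" for x
    by (rule step_derivative_zero[OF H(2,3) that])
  moreover have "continuous_on UNIV ?H'" by (intro smooth_on_continuous H smooth_on_vderiv)
  ultimately have "(LINT y|lborel. ?H' y) = 1 - 0"
  proof (intro integral_vector_derivative_real_line[of H] integrable_compact_support[of _ 0 w])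
    show "(H has_vector_derivative ?H' x) (at x)" for x
      by (rule smooth_on_has_vderiv[OF H(1)]) simp
    show "(H \<longlongrightarrow> 0) at_bot"
      by (rule tendsto_eventually, rule eventually_mono[OF eventually_le_at_bot[of 0]]) (simp add: H)
    show "(H \<longlongrightarrow> 1) at_top"
      by (rule tendsto_eventually, rule eventually_mono[OF eventually_gt_at_top[of w]]) (simp add: H)
  qed auto
  then show ?thesis by simp
qed

text \<open>The chirp cancels the quadratic phase of the kernel, so the value of the transform at \<open>rk\<close> is, up to
  a factor, the Fourier transform of the bump at \<open>rk/s = \<plusminus>k/p\<close> with \<open>p = \<bar>s\<bar>/r\<close>. Only the term
  \<open>k = 0\<close> of the comb survives.\<close>

lemma comb_transform_chirped_bump_nonzero:
  assumes \<alpha>: "\<bar>\<alpha>\<bar> < 2" "\<alpha> \<noteq> 0" and "r > 0" "w > 0"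
    and H: "smooth_on UNIV H" "\<And>x. x \<le> 0 \<Longrightarrow> H x = 0" "\<And>x. x \<ge> w \<Longrightarrow> H x = 1"
  defines "s \<equiv> sin (pi * \<alpha> / 2)" and "c \<equiv> cos (pi * \<alpha> / 2)"
  shows "comb_transform \<alpha> r (\<lambda>y. exp (\<i> * of_real (- (pi * c / s) * y\<^sup>2)) * (H y - H (y - \<bar>s\<bar> / r))) \<noteq> 0"
proof -
  define p where "p = \<bar>s\<bar> / r"
  define q where "q = 1 / csqrt (\<i> * of_real s)"
  have s: "s \<noteq> 0" unfolding s_def using \<alpha> by (rule sin_half_pi_nonzero)
  have p: "p > 0" using s assms(3) by (simp add: p_def)
  define g where "g y = exp (\<i> * of_real (- (pi * c / s) * y\<^sup>2)) * (H y - H (y - p))" for y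
  have base: "frac_fourier_base \<alpha> g x = q * exp (\<i> * of_real (pi * c / s * x\<^sup>2)) *
      (LINT y|lborel. exp (\<i> * of_real ((- 2 * pi * x / s) * y)) * (H y - H (y - p)))" for x
  proof -
    have e: "exp (\<i> * of_real (pi * c / s * y\<^sup>2 + (- 2 * pi * x / s) * y)) * g y =
        exp (\<i> * of_real ((- 2 * pi * x / s) * y)) * (H y - H (y - p))" for y
    proof -
      have "exp (\<i> * of_real (pi * c / s * y\<^sup>2 + (- 2 * pi * x / s) * y)) * exp (\<i> * of_real (- (pi * c / s) * y\<^sup>2)) =
          exp (\<i> * of_real ((pi * c / s * y\<^sup>2 + (- 2 * pi * x / s) * y) + - (pi * c / s) * y\<^sup>2))"
        by (simp only: exp_add[symmetric] distrib_left[symmetric] of_real_add[symmetric])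
      then show ?thesis unfolding g_def by (simp only: mult.assoc[symmetric]) simp
    qed
    show ?thesis
      unfolding frac_fourier_base_chirp[OF \<alpha>(2) s_def[THEN meta_eq_to_obj_eq] s c_def[THEN meta_eq_to_obj_eq]] e q_def ..
  qed
  note step = integral_step_difference[OF H _ _ assms(4) p]
  have nonzero: "frac_fourier_base \<alpha> g (r * of_int k) = 0" if "k \<noteq> 0" for k
  proof -
    define l where "l = - 2 * pi * (r * of_int k) / s"
    have l: "l \<noteq> 0" using s that assms(3) by (simp add: l_def)
    define e where "e y = exp (\<i> * of_real (l * y))" for y
    define E where "E y = 1 / (\<i> * of_real l) * e y" for y
    have "(E has_vector_derivative e y) (at y)" for y
    proof -
      have "((\<lambda>y. l * y) has_real_derivative l) (at y)" by (auto intro!: derivative_eq_intros)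
      then have "((\<lambda>y. \<i> * of_real (l * y)) has_vector_derivative \<i> * of_real l) (at y)"
        by (intro has_vector_derivative_mult_right has_vector_derivative_of_real)
      from has_vector_derivative_mult_right[OF field_vector_diff_chain_at[OF this DERIV_exp], of "1 / (\<i> * of_real l)"]
      show ?thesis using l by (simp add: o_def e_def E_def[abs_def])
    qed
    moreover have "continuous_on UNIV e" unfolding e_def[abs_def] by (intro continuous_intros)
    moreover have "E (z + p) = E z" for z
    proof -
      have "l * p = 2 * pi * of_int (- k * (if s > 0 then 1 else - 1))"
        using s assms(3) by (auto simp: l_def p_def field_simps)
      then have "exp (\<i> * of_real (l * p)) = 1" by (simp only: exp_2pi_int)
      then show ?thesis
        by (simp add: E_def e_def distrib_left exp_add)
    qed
    ultimately have "(LINT y|lborel. e y * (H y - H (y - p))) = 0"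
      using step[of E e] by simp
    then show ?thesis unfolding base l_def[symmetric] e_def by simp
  qed
  have zero: "frac_fourier_base \<alpha> g 0 = q * of_real p"
  proof -
    have "(LINT y|lborel. 1 * (H y - H (y - p))) =
        (LINT z|lborel. vector_derivative H (at z) * (of_real (z + p) - of_real z))"
      by (rule step) (auto intro!: has_vector_derivative_of_real derivative_eq_intros)
    also have "\<dots> = of_real p" by (simp add: integral_step_derivative[OF H])
    finally show ?thesis unfolding base by simp
  qed
  have "comb_transform \<alpha> r g = (\<Sum>\<^sub>\<infinity>k\<in>{0::int}. frac_fourier_base \<alpha> g (r * of_int k))"
    unfolding comb_transform_def by (rule infsum_cong_neutral) (auto simp: nonzero)
  also have "\<dots> = q * of_real p" by (simp add: zero)
  finally have "comb_transform \<alpha> r g \<noteq> 0" using p s by (simp add: q_def)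
  then show ?thesis unfolding g_def[abs_def] p_def .
qed

text \<open>If the functional vanished on \<open>V\<close>, then by invariance under a dense group of translations (with
  modulations) it would vanish on every smooth function whose support is short compared with \<open>V\<close>. The
  bump \<open>H(y) - H(y - p)\<close> telescopes into translates of \<open>H(y) - H(y - p/n)\<close>, whose supports have
  length \<open>p/n + w\<close>; so the functional would vanish on the chirped bump too.\<close>

lemma comb_transform_vanishes_nowhere:
  assumes \<alpha>: "\<bar>\<alpha>\<bar> < 2" and "r > 0"
    and ind: "\<not> int_lin_dependent (r * cos (pi * \<alpha> / 2)) (1 / r * sin (pi * \<alpha> / 2))"
    and V: "open V" "v \<in> V"
  shows "\<exists>\<phi>\<in>test_functions_on V. comb_transform \<alpha> r \<phi> \<noteq> 0"
proof (rule ccontr)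
  assume "\<not> (\<exists>\<phi>\<in>test_functions_on V. comb_transform \<alpha> r \<phi> \<noteq> 0)"
  then have van: "comb_transform \<alpha> r \<phi> = 0" if "\<phi> \<in> test_functions_on V" for \<phi>
    using that by blast
  define s where "s = sin (pi * \<alpha> / 2)"
  define c where "c = cos (pi * \<alpha> / 2)"
  have "\<alpha> \<noteq> 0"
  proof
    assume "\<alpha> = 0"
    then have "int_lin_dependent (r * cos (pi * \<alpha> / 2)) (1 / r * sin (pi * \<alpha> / 2))"
      unfolding int_lin_dependent_def by (intro exI[of _ 0] exI[of _ 1]) simp
    then show False using ind by contradiction
  qed
  obtain \<delta> where \<delta>: "\<delta> > 0" "ball v \<delta> \<subseteq> V" using V openE by blast
  \<comment> \<open>The step has width \<open>w\<close> and consecutive pieces are shifted by \<open>t = p/n < \<delta>/2\<close>, so each piece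
    lives on an interval of length less than \<open>\<delta>\<close>, half the length of the ball around \<open>v\<close>.\<close>
  define w where "w = \<delta> / 2"
  have w: "w > 0" using \<delta> by (simp add: w_def)
  obtain H where H: "smooth_on UNIV H" "\<And>x. x \<le> 0 \<Longrightarrow> H x = 0" "\<And>x. x \<ge> w \<Longrightarrow> H x = 1"
    using smooth_step_exists[OF w] by blast
  define p where "p = \<bar>s\<bar> / r"
  obtain n :: nat where n: "n > 0" "p / n < \<delta> / 2"
  proof -
    obtain n :: nat where "p / (\<delta> / 2) < real n" using reals_Archimedean2 by blast
    then have "p / real (Suc n) < \<delta> / 2" using \<delta> by (simp add: field_simps)
    then show ?thesis using that[of "Suc n"] by simp
  qed
  define t where "t = p / n"
  have t0: "t \<ge> 0" unfolding t_def p_def using assms(2) by simp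
  define g where "g u u' y = exp (\<i> * of_real (- (pi * c / s) * y\<^sup>2)) * (H (y - u) - H (y - u'))"
    for u u' y
  have smg: "smooth_on UNIV (g u u')" for u u'
  proof -
    have "smooth_on UNIV (\<lambda>y. exp (\<i> * of_real (- (pi * c / s) * y\<^sup>2 + 0 * y + 0)) *
        (H (1 * y + - u) - H (1 * y + - u')))"
      by (intro smooth_on_mult smooth_on_chirp smooth_on_diff smooth_on_affine H) auto
    then show ?thesis by (simp add: g_def[abs_def])
  qed
  have g0: "g u u' y = 0" if "y \<notin> {u .. u' + w}" "u \<le> u'" for u u' y
    using that w by (cases "y < u") (auto simp: g_def H)
  have S: "g u u' \<in> schwartz" if "u \<le> u'" for u u'
    using test_functions_onI[OF smg[of u u'] g0[OF _ that], where U = UNIV] test_functions_on_schwartz by blast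
  have zero: "comb_transform \<alpha> r (g u (u + t)) = 0" for u
  proof -
    have uu: "u \<le> u + t" by (simp add: t0)
    \<comment> \<open>Moves the left end \<open>u\<close> of the piece into \<open>(v - \<delta>, v)\<close>, hence the piece into the ball.\<close>
    obtain m k :: int where mk: "\<bar>m * (r * c) - k * (1 / r * s) - (v - \<delta> / 2 - u)\<bar> < \<delta> / 2"
      using int_combinations_dense[OF ind, of "\<delta> / 2"] \<delta> unfolding s_def c_def by (metis half_gt_zero)
    define a where "a = m * r * c - k * s / r"
    define b where "b = m * r * s + k * c / r"
    have a: "\<bar>a - (v - \<delta> / 2 - u)\<bar> < \<delta> / 2"
      using mk by (simp add: a_def mult_ac)
    have "heisenberg a b (g u (u + t)) \<in> test_functions_on V"
    proof (rule test_functions_onI[OF smooth_on_heisenberg[OF smg]])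
      show "heisenberg a b (g u (u + t)) x = 0" if "x \<notin> {a + u .. a + u + t + w}" for x
        using that g0[of "x - a" u "u + t", OF _ uu] by (auto simp: heisenberg_def)
      have "{a + u .. a + u + t + w} \<subseteq> {v - \<delta> <..< v + \<delta>}"
      proof -
        have "v - \<delta> < a + u" "a + u + t + w < v + \<delta>"
          using a n(2) unfolding t_def[symmetric] w_def by linarith+
        then show ?thesis by auto
      qed
      then show "{a + u .. a + u + t + w} \<subseteq> V" using \<delta> by (auto simp: ball_eq_greaterThanLessThan)
    qed
    then have "comb_transform \<alpha> r (heisenberg a b (g u (u + t))) = 0" by (rule van)
    then show ?thesis
      using comb_transform_heisenberg[OF \<alpha>, of r m k "g u (u + t)"] assms(2)
      unfolding s_def[symmetric] c_def[symmetric] a_def[symmetric] b_def[symmetric] by simp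
  qed
  have sum: "comb_transform \<alpha> r (g 0 (real N * t)) = 0" for N
  proof (induction N)
    case 0
    have "g 0 0 = (\<lambda>y. 0 * g 0 0 y + 0 * g 0 0 y)" by (simp add: g_def[abs_def])
    then have "comb_transform \<alpha> r (g 0 0) = 0 * comb_transform \<alpha> r (g 0 0) + 0 * comb_transform \<alpha> r (g 0 0)"
      using comb_transform_linear[OF \<alpha> _ S[of 0 0] S[of 0 0], of r 0 0] assms(2) by simp
    then show ?case by simp
  next
    case (Suc N)
    define u where "u = real N * t"
    have u: "0 \<le> u" "u \<le> u + t" "real (Suc N) * t = u + t" using t0 by (simp_all add: u_def algebra_simps)
    have "g 0 (u + t) = (\<lambda>y. 1 * g 0 u y + 1 * g u (u + t) y)"
      by (simp add: g_def[abs_def] algebra_simps)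
    then have "comb_transform \<alpha> r (g 0 (u + t)) = 1 * comb_transform \<alpha> r (g 0 u) + 1 * comb_transform \<alpha> r (g u (u + t))"
      using comb_transform_linear[OF \<alpha> _ S[OF u(1)] S[OF u(2)], of r 1 1] assms(2) by simp
    then show ?case unfolding u(3) using Suc zero[of u] by (simp add: u_def)
  qed
  have "real n * t = p" using n(1) by (simp add: t_def)
  then have "comb_transform \<alpha> r (g 0 p) = 0" using sum[of n] by simp
  moreover have "comb_transform \<alpha> r (g 0 p) \<noteq> 0"
    using comb_transform_chirped_bump_nonzero[OF \<alpha> \<open>\<alpha> \<noteq> 0\<close> assms(2) w H]
    by (simp add: g_def[abs_def] s_def c_def p_def)
  ultimately show False by contradiction
qed

section \<open>Reduction to exponents in the base range, and the dichotomy\<close>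

text \<open>Adding \<open>2k\<close> to the exponent rotates by \<open>k\<pi>\<close>, which amounts to the sign \<open>\<sigma> = (-1)\<^sup>k\<close> and a constant.
  The sign affects neither the comb, which is even, nor linear dependence.\<close>

lemma frac_fourier_reduce:
  obtains \<beta> \<sigma> :: real and \<kappa> :: complex where "\<bar>\<beta>\<bar> < 2" "\<kappa> \<noteq> 0" "\<sigma> = 1 \<or> \<sigma> = - 1"
    "\<And>f x. frac_fourier \<alpha> f x = \<kappa> * frac_fourier_base \<beta> f (\<sigma> * x)"
    "cos (pi * \<alpha> / 2) = \<sigma> * cos (pi * \<beta> / 2)" "sin (pi * \<alpha> / 2) = \<sigma> * sin (pi * \<beta> / 2)"
proof (cases "\<bar>\<alpha>\<bar> < 2")
  case True
  then show ?thesis using that[of \<alpha> 1 1] by (simp add: frac_fourier_def)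
next
  case False
  define k where "k = \<lfloor>\<alpha> / 2\<rfloor>"
  define \<beta> where "\<beta> = \<alpha> - 2 * of_int k"
  define \<sigma> :: real where "\<sigma> = (-1) powi k"
  have "of_int k \<le> \<alpha> / 2" "\<alpha> / 2 < of_int k + 1" unfolding k_def by linarith+
  then have \<beta>: "\<bar>\<beta>\<bar> < 2" by (simp add: \<beta>_def)
  have arg: "pi * \<alpha> / 2 = pi * \<beta> / 2 + pi * of_int k" by (simp add: \<beta>_def field_simps)
  have sg: "\<sigma> = 1 \<or> \<sigma> = - 1" by (cases "even k") (auto simp: \<sigma>_def)
  have ck: "cos (pi * of_int k) = \<sigma>" "sin (pi * of_int k) = 0"
    by (auto simp: \<sigma>_def power_int_minus_left cos_npi_int sin_npi_int)
  show ?thesis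
  proof (rule that[OF \<beta> _ sg])
    show "exp (- pi * \<i> / 2 * of_int k) \<noteq> 0" by simp
    show "frac_fourier \<alpha> f x = exp (- pi * \<i> / 2 * of_int k) * frac_fourier_base \<beta> f (\<sigma> * x)" for f x
      using False by (simp add: frac_fourier_def Let_def k_def[symmetric] \<beta>_def \<sigma>_def)
    show "cos (pi * \<alpha> / 2) = \<sigma> * cos (pi * \<beta> / 2)" "sin (pi * \<alpha> / 2) = \<sigma> * sin (pi * \<beta> / 2)"
      unfolding arg cos_add sin_add ck by simp_all
  qed
qed

lemma int_lin_dependent_sign:
  assumes "\<sigma> = 1 \<or> \<sigma> = - 1"
  shows "int_lin_dependent (a * (\<sigma> * x)) (b * (\<sigma> * y)) \<longleftrightarrow> int_lin_dependent (a * x) (b * y)"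
proof -
  have "of_int m * (a * (\<sigma> * x)) + of_int n * (b * (\<sigma> * y)) = \<sigma> * (of_int m * (a * x) + of_int n * (b * y))"
    for m n :: int by (simp add: algebra_simps)
  then show ?thesis using assms by (auto simp: int_lin_dependent_def)
qed

lemma frac_fourier_dist_dirac_comb:
  assumes "r > 0"
  obtains \<beta> :: real and \<kappa> :: complex where "\<bar>\<beta>\<bar> < 2" "\<kappa> \<noteq> 0"
    "frac_fourier_dist \<alpha> (dirac_comb r) = (\<lambda>\<phi>. \<kappa> * comb_transform \<beta> r \<phi>)"
    "int_lin_dependent (r * cos (pi * \<alpha> / 2)) (1 / r * sin (pi * \<alpha> / 2)) \<longleftrightarrow>
     int_lin_dependent (r * cos (pi * \<beta> / 2)) (1 / r * sin (pi * \<beta> / 2))"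
proof -
  obtain \<beta> \<sigma> :: real and \<kappa> :: complex where red: "\<bar>\<beta>\<bar> < 2" "\<kappa> \<noteq> 0" "\<sigma> = 1 \<or> \<sigma> = - 1"
    "\<And>f x. frac_fourier \<alpha> f x = \<kappa> * frac_fourier_base \<beta> f (\<sigma> * x)"
    "cos (pi * \<alpha> / 2) = \<sigma> * cos (pi * \<beta> / 2)" "sin (pi * \<alpha> / 2) = \<sigma> * sin (pi * \<beta> / 2)"
    using frac_fourier_reduce[of \<alpha>] by metis
  have even: "(\<Sum>\<^sub>\<infinity>k::int. frac_fourier_base \<beta> f (\<sigma> * (r * of_int k))) = comb_transform \<beta> r f" for f
  proof -
    have "(\<Sum>\<^sub>\<infinity>k::int. frac_fourier_base \<beta> f (r * of_int (- k))) = comb_transform \<beta> r f"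
      unfolding comb_transform_def
      by (rule infsum_reindex_bij_betw) (rule bij_betwI[of _ _ _ uminus], auto)
    then show ?thesis using red(3) by (auto simp: comb_transform_def)
  qed
  have "frac_fourier_dist \<alpha> (dirac_comb r) = (\<lambda>\<phi>. (of_real (sqrt r) * \<kappa>) * comb_transform \<beta> r \<phi>)"
    by (simp add: frac_fourier_dist_def[abs_def] dirac_comb_def red(4) infsum_cmult_right' even mult.assoc)
  then show ?thesis
    using that[OF red(1), of "of_real (sqrt r) * \<kappa>"] red(2) assms
    unfolding red(5,6) int_lin_dependent_sign[OF red(3)] by simp
qed

theorem theorem1p2:
  fixes \<alpha> r :: real
  assumes "r > 0"
  shows "tempered_distribution (frac_fourier_dist \<alpha> (dirac_comb r)) \<and>
    (discrete (dist_support (frac_fourier_dist \<alpha> (dirac_comb r))) \<longleftrightarrow>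
       int_lin_dependent (r * cos (pi * \<alpha> / 2)) (1 / r * sin (pi * \<alpha> / 2))) \<and>
    (\<not> int_lin_dependent (r * cos (pi * \<alpha> / 2)) (1 / r * sin (pi * \<alpha> / 2)) \<longrightarrow>
       dist_support (frac_fourier_dist \<alpha> (dirac_comb r)) = UNIV)"
proof -
  obtain \<beta> :: real and \<kappa> :: complex where \<beta>: "\<bar>\<beta>\<bar> < 2" and \<kappa>: "\<kappa> \<noteq> 0"
    and u: "frac_fourier_dist \<alpha> (dirac_comb r) = (\<lambda>\<phi>. \<kappa> * comb_transform \<beta> r \<phi>)"
    and dep: "int_lin_dependent (r * cos (pi * \<alpha> / 2)) (1 / r * sin (pi * \<alpha> / 2)) \<longleftrightarrow>
     int_lin_dependent (r * cos (pi * \<beta> / 2)) (1 / r * sin (pi * \<beta> / 2))"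
    by (rule frac_fourier_dist_dirac_comb[OF assms, of \<alpha>])
  have r: "r \<noteq> 0" using assms by simp
  define u where "u = (\<lambda>\<phi>. \<kappa> * comb_transform \<beta> r \<phi>)"
  have "tempered_distribution u"
    unfolding tempered_distribution_def
  proof (intro conjI ballI allI)
    show "u (\<lambda>x. a * \<phi> x + b * \<psi> x) = a * u \<phi> + b * u \<psi>" if "\<phi> \<in> schwartz" "\<psi> \<in> schwartz" for \<phi> \<psi> a b
      unfolding u_def comb_transform_linear[OF \<beta> r that] by (simp add: algebra_simps)
    obtain C where C: "\<And>\<phi>. \<phi> \<in> schwartz \<Longrightarrow> norm (comb_transform \<beta> r \<phi>) \<le> C * schwartz_norm 4 \<phi>"
      using comb_transform_bound[OF \<beta> r] by metis
    have "norm (u \<phi>) \<le> (norm \<kappa> * C) * schwartz_norm 4 \<phi>" if "\<phi> \<in> schwartz" for \<phi>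
      using mult_left_mono[OF C[OF that], of "norm \<kappa>"] by (simp add: u_def norm_mult mult.assoc)
    then show "\<exists>C N. \<forall>\<phi>\<in>schwartz. norm (u \<phi>) \<le> C * schwartz_norm N \<phi>" by blast
  qed
  moreover have "discrete (dist_support u)"
    if d: "int_lin_dependent (r * cos (pi * \<beta> / 2)) (1 / r * sin (pi * \<beta> / 2))"
  proof -
    obtain b where b: "b \<noteq> 0"
      "\<And>f. comb_transform \<beta> r (\<lambda>x. exp (\<i> * of_real (2 * pi * b * x)) * f x) = comb_transform \<beta> r f"
      using dependent_modulation[OF \<beta> assms d] by blast
    have "open (- {x. b * x \<in> \<int>})" by (rule open_Compl[OF int_multiples_closed])
    moreover have "\<forall>\<phi>\<in>test_functions_on (- {x. b * x \<in> \<int>}). u \<phi> = 0"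
      using comb_transform_vanishes_off_lattice[OF \<beta> r b(2)] by (simp add: u_def)
    ultimately have "dist_support u \<subseteq> {x. b * x \<in> \<int>}"
      unfolding dist_support_def by blast
    then show ?thesis using int_multiples_discrete[OF b(1)] discrete_subset by blast
  qed
  moreover have full: "dist_support u = UNIV"
    if ind: "\<not> int_lin_dependent (r * cos (pi * \<beta> / 2)) (1 / r * sin (pi * \<beta> / 2))"
    using comb_transform_vanishes_nowhere[OF \<beta> assms ind] \<kappa> unfolding dist_support_def u_def by fastforce
  moreover have "\<not> discrete (UNIV :: real set)"
    by (simp add: discrete_altdef)
  ultimately show ?thesis unfolding u u_def[symmetric] dep by metis
qed

end
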